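(* Let $n\ge1$, let $L$ be a lattice of rank $n$, and let $\Delta=\Delta(I)$ be the fan in $L$ consisting of all faces of an $n$-dimensional simplicial strongly convex rational cone $C(I)$, with edge vectors $\mathcal V=\{v_i\}_{i\in I}$ and a $\mathbb Q$-divisor $\xi=\sum_{i\in I}d_ix_i$. Let $\Delta'$ be a simplicial fan in $L$ with a map $\rho:\Delta'\to\Delta$ satisfying conditions a) and b) of the context, let $\mathcal V'$ be a set of edge vectors for $\Delta'$, and put $\xi'=\rho^*(\xi)$. Then for every face $J\subset I$ (including $J=\emptyset$ and $J=I$), $$b_J(\Delta',\mathcal V',\xi';\Delta,\mathcal V,\xi):=\sum_{J'\in\Sigma',\ \rho(J')=J}b_{J'}(\Delta',\mathcal V',\xi')-b_J(\Delta,\mathcal V,\xi)=0$$ as functions on $L^*$.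
   Context: **Setting.** $I$ is a set with $n$ elements; $\Sigma=\Sigma(I)$ is the set of all subsets (faces) of $I$, and $J\mapsto C(J)$ is the isomorphism of ordered sets from $\Sigma$ onto the set of faces of the cone $C(I)\subset L_{\mathbb R}=L\otimes\mathbb R$ ($\dim C(J)=|J|$, $C(\emptyset)=\{0\}$). $\Delta'$ is a simplicial fan with associated simplicial complex $\Sigma'$ (including the empty simplex, with vertex set $\Sigma'^{(1)}$), the cone of $J'\in\Sigma'$ being $C'(J')$, and: a) there is an injection $\kappa:I\to\Sigma'^{(1)}$ with $C(i)=C'(\kappa(i))$ for $i\in I$; b) for each $J'\in\Sigma'$ there is $J\in\Sigma$ with $C'(J')\subset C(J)$, and for each $J\in\Sigma$ the cones $C'(J')$ contained in $C(J)$ form a subdivision of $C(J)$; $\rho(J')$ denotes the minimal $J\in\Sigma$ with $C'(J')\subset C(J)$. **Edge vectors.** $\mathcal V=\{v_i\}_{i\in I}$, $0\ne v_i\in L\cap C(i)$, and $\mathcal V'=\{v_{i'}\}_{i'\in\Sigma'^{(1)}}$, $0\ne v_{i'}\in L\cap C'(i')$; they need not be primitive and $v_{\kappa(i)}$ may differ from $v_i$. A $\mathbb Q$-divisor $\xi=\sum_id_ix_i$ ($d_i\in\mathbb Q$) is a formal rational combination of indeterminates $x_i$, one for each edge (degree-two element of the Stanley–Reisner ring). Write $v_{i'}=\sum_{i\in I}a_{i'i}v_i$ with $a_{i'i}\in\mathbb Q_{\ge0}$. The pull-back is $\xi'=\rho^*(\xi)=\sum_{i'\in\Sigma'^{(1)}}d_{i'}x_{i'}$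 with $d_{i'}=\sum_{i\in I}a_{i'i}d_i$. **The functions $b_J$.** For $(\Delta,\mathcal V,\xi)$ (and likewise for $(\Delta',\mathcal V',\xi')$) and a simplex $J$ let $L_J=L\cap\operatorname{span}_{\mathbb R}C(J)$, $L_{J,\mathcal V}$ the sublattice generated by $\{v_i\}_{i\in J}$, $\{u_i^J\}_{i\in J}$ the basis dual to $\{v_i\}_{i\in J}$, $H_J=L_J/L_{J,\mathcal V}$. For $h\in H_J$ let $v_{J,h}\in L_J$ be the unique representative of $h$ with $f_{h,i}:=\langle u_i^J,v_{J,h}\rangle\in[0,1)$ for all $i\in J$, and put $f_{J,h}(\xi)=\sum_{i\in J}d_if_{h,i}$. Fix $\tau$ with $\Im\tau>0$ and $\sigma\in\mathbb C$, $q^a=e^{2\pi\sqrt{-1}a\tau}$, $\zeta^a=e^{2\pi\sqrt{-1}a\sigma}$. Then $b_J(\Delta,\mathcal V,\xi)$ is the function $$L^*\ni u\longmapsto(-1)^{n-|J|}\sum_{h\in H_J}\zeta^{f_{J,h}(\xi)}q^{\langle u,v_{J,h}\rangle}\prod_{i\in J}\frac1{1-\zeta^{d_i}q^{\langle u,v_i\rangle}}.$$ It is understood that $d_i\sigma,\ d_{i'}\sigma\notin\mathbb Z+\mathbb Z\tau$ for all $i,i'$, so that these functions are defined. *)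

theory Defs
  imports "HOL-Analysis.Analysis"
begin

section \<open>Lattices and cones\<close>

text \<open>A lattice \<open>L\<close> is realised inside \<open>L \<otimes> \<real>\<close>, which is the whole ambient
  space; so its rank is \<open>DIM('a)\<close>.\<close>

definition int_span :: "'a::real_vector set \<Rightarrow> 'a set" where
  "int_span B = {\<Sum>b\<in>B. of_int (c b) *\<^sub>R b | c :: 'a \<Rightarrow> int. True}"

definition is_lattice :: "'a::euclidean_space set \<Rightarrow> bool" where
  "is_lattice L \<longleftrightarrow> (\<exists>B. independent B \<and> span B = UNIV \<and> L = int_span B)"

text \<open>As \<open>L\<close> spans the ambient space, \<open>Hom(L, \<int>)\<close> is identified with the linear forms that
  are integral on \<open>L\<close>.\<close>

definition dual_lattice :: "'a::euclidean_space set \<Rightarrow> ('a \<Rightarrow> real) set" where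
  "dual_lattice L = {u. linear u \<and> (\<forall>w\<in>L. u w \<in> \<int>)}"

definition rational_cone :: "'a::euclidean_space set \<Rightarrow> 'a set \<Rightarrow> bool" where
  "rational_cone L S \<longleftrightarrow> (\<exists>G. finite G \<and> G \<subseteq> L \<and> S = convex_cone hull G)"

definition strongly_convex :: "'a::euclidean_space set \<Rightarrow> bool" where
  "strongly_convex S \<longleftrightarrow> (\<forall>x\<in>S. - x \<in> S \<longrightarrow> x = 0)"

definition simplicial_cone :: "'a::euclidean_space set \<Rightarrow> bool" where
  "simplicial_cone S \<longleftrightarrow> (\<exists>G. independent G \<and> S = convex_cone hull G)"

text \<open>The library relation \<open>face_of\<close> counts the empty set as a face; it is not a face in
  the sense of cones.\<close>

definition cone_faces :: "'a::euclidean_space set \<Rightarrow> 'a set set" where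
  "cone_faces S = {F. F face_of S \<and> F \<noteq> {}}"


section \<open>Fans\<close>

definition is_fan :: "'a::euclidean_space set \<Rightarrow> 'a set set \<Rightarrow> bool" where
  "is_fan L D \<longleftrightarrow> finite D \<and>
     (\<forall>S\<in>D. rational_cone L S \<and> strongly_convex S) \<and>
     (\<forall>S\<in>D. cone_faces S \<subseteq> D) \<and>
     (\<forall>S\<in>D. \<forall>T\<in>D. S \<inter> T \<in> cone_faces S \<and> S \<inter> T \<in> cone_faces T)"

definition abstract_complex :: "'k set set \<Rightarrow> bool" where
  "abstract_complex \<Sigma> \<longleftrightarrow> finite \<Sigma> \<and> {} \<in> \<Sigma> \<and>
     (\<forall>J\<in>\<Sigma>. finite J \<and> (\<forall>K. K \<subseteq> J \<longrightarrow> K \<in> \<Sigma>))"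

definition vertices :: "'k set set \<Rightarrow> 'k set" where
  "vertices \<Sigma> = {i. {i} \<in> \<Sigma>}"

text \<open>A simplicial fan with cones \<open>C J\<close> indexed, compatibly with the order, by the simplices
  \<open>J\<close> of the abstract simplicial complex \<open>\<Sigma>\<close>.\<close>

definition simplicial_fan ::
  "'a::euclidean_space set \<Rightarrow> 'k set set \<Rightarrow> ('k set \<Rightarrow> 'a set) \<Rightarrow> bool" where
  "simplicial_fan L \<Sigma> C \<longleftrightarrow> abstract_complex \<Sigma> \<and> is_fan L (C ` \<Sigma>) \<and>
     (\<forall>J\<in>\<Sigma>. simplicial_cone (C J) \<and> dim (C J) = card J) \<and>
     (\<forall>J\<in>\<Sigma>. \<forall>K\<in>\<Sigma>. C J \<subseteq> C K \<longleftrightarrow> J \<subseteq> K)"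

text \<open>The fan \<open>\<Delta>(I)\<close> of all faces of the cone \<open>C I\<close>, where \<open>J \<mapsto> C J\<close> is the isomorphism
  of ordered sets from the subsets of \<open>I\<close> onto the faces.\<close>

definition face_fan ::
  "'a::euclidean_space set \<Rightarrow> 'i set \<Rightarrow> ('i set \<Rightarrow> 'a set) \<Rightarrow> bool" where
  "face_fan L I C \<longleftrightarrow>
     rational_cone L (C I) \<and> strongly_convex (C I) \<and> simplicial_cone (C I) \<and>
     bij_betw C (Pow I) (cone_faces (C I)) \<and>
     (\<forall>J\<in>Pow I. \<forall>K\<in>Pow I. C J \<subseteq> C K \<longleftrightarrow> J \<subseteq> K) \<and>
     (\<forall>J\<in>Pow I. dim (C J) = card J)"

definition subdivides :: "'a::euclidean_space set \<Rightarrow> 'a set set \<Rightarrow> 'a set \<Rightarrow> bool" where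
  "subdivides L D S \<longleftrightarrow> is_fan L D \<and> \<Union>D = S"

definition fan_refinement ::
  "'a::euclidean_space set \<Rightarrow> 'k set set \<Rightarrow> ('k set \<Rightarrow> 'a set) \<Rightarrow>
   'i set set \<Rightarrow> ('i set \<Rightarrow> 'a set) \<Rightarrow> bool" where
  "fan_refinement L \<Sigma>' C' \<Sigma> C \<longleftrightarrow>
     (\<forall>J'\<in>\<Sigma>'. \<exists>J\<in>\<Sigma>. C' J' \<subseteq> C J) \<and>
     (\<forall>J\<in>\<Sigma>. subdivides L {C' J' | J'. J' \<in> \<Sigma>' \<and> C' J' \<subseteq> C J} (C J))"

definition carrier_face ::
  "('k set \<Rightarrow> 'a set) \<Rightarrow> 'i set set \<Rightarrow> ('i set \<Rightarrow> 'a set) \<Rightarrow> 'k set \<Rightarrow> 'i set" where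
  "carrier_face C' \<Sigma> C J' = (LEAST J. J \<in> \<Sigma> \<and> C' J' \<subseteq> C J)"


section \<open>Edge vectors and divisors\<close>

definition edge_vectors ::
  "'a::euclidean_space set \<Rightarrow> 'k set \<Rightarrow> ('k set \<Rightarrow> 'a set) \<Rightarrow> ('k \<Rightarrow> 'a) \<Rightarrow> bool" where
  "edge_vectors L E C v \<longleftrightarrow> (\<forall>i\<in>E. v i \<noteq> 0 \<and> v i \<in> L \<inter> C {i})"

text \<open>\<open>dual_coord v J i\<close> is the form \<open>u_i^J\<close> of the basis dual to \<open>(v i)\<close>, \<open>i \<in> J\<close>, of the
  span of these (linearly independent) vectors.\<close>

definition dual_coord :: "('k \<Rightarrow> 'a::euclidean_space) \<Rightarrow> 'k set \<Rightarrow> 'k \<Rightarrow> 'a \<Rightarrow> real" where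
  "dual_coord v J i w = representation (v ` J) w (v i)"

text \<open>The divisor \<open>\<Sum>i. d i x_i\<close> is given by its coefficients. In the pull-back,
  \<open>dual_coord v I i (v' i')\<close> is the coefficient \<open>a_{i'i}\<close> of \<open>v i\<close> in \<open>v' i'\<close>.\<close>

definition pullback_divisor ::
  "'i set \<Rightarrow> ('i \<Rightarrow> 'a::euclidean_space) \<Rightarrow> ('i \<Rightarrow> real) \<Rightarrow> ('k \<Rightarrow> 'a) \<Rightarrow> 'k \<Rightarrow> real" where
  "pullback_divisor I v d v' i' = (\<Sum>i\<in>I. dual_coord v I i (v' i') * d i)"


section \<open>The functions \<open>b_J\<close>\<close>

definition face_lattice :: "'a::euclidean_space set \<Rightarrow> ('k set \<Rightarrow> 'a set) \<Rightarrow> 'k set \<Rightarrow> 'a set" where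
  "face_lattice L C J = L \<inter> span (C J)"

text \<open>The elements of \<open>H_J\<close> are the cosets in \<open>L_J\<close> of the sublattice generated by the
  \<open>v i\<close>, \<open>i \<in> J\<close>.\<close>

definition H_quot ::
  "'a::euclidean_space set \<Rightarrow> ('k set \<Rightarrow> 'a set) \<Rightarrow> ('k \<Rightarrow> 'a) \<Rightarrow> 'k set \<Rightarrow> 'a set set" where
  "H_quot L C v J = face_lattice L C J //
     {(x, y). x \<in> face_lattice L C J \<and> y \<in> face_lattice L C J \<and> x - y \<in> int_span (v ` J)}"

definition box_rep :: "('k \<Rightarrow> 'a::euclidean_space) \<Rightarrow> 'k set \<Rightarrow> 'a set \<Rightarrow> 'a" where
  "box_rep v J h = (THE w. w \<in> h \<and> (\<forall>i\<in>J. 0 \<le> dual_coord v J i w \<and> dual_coord v J i w < 1))"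

definition frac_weight ::
  "('k \<Rightarrow> 'a::euclidean_space) \<Rightarrow> ('k \<Rightarrow> real) \<Rightarrow> 'k set \<Rightarrow> 'a set \<Rightarrow> real" where
  "frac_weight v d J h = (\<Sum>i\<in>J. d i * dual_coord v J i (box_rep v J h))"

text \<open>Thus \<open>q^a = expi \<tau> a\<close> and \<open>\<zeta>^a = expi \<sigma> a\<close>.\<close>

definition expi :: "complex \<Rightarrow> real \<Rightarrow> complex" where
  "expi s a = exp (2 * of_real pi * \<i> * of_real a * s)"

definition b_fun ::
  "complex \<Rightarrow> complex \<Rightarrow> 'a::euclidean_space set \<Rightarrow> ('k set \<Rightarrow> 'a set) \<Rightarrow> ('k \<Rightarrow> 'a) \<Rightarrow>
   ('k \<Rightarrow> real) \<Rightarrow> 'k set \<Rightarrow> ('a \<Rightarrow> real) \<Rightarrow> complex" where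
  "b_fun \<tau> \<sigma> L C v d J u =
     (-1) ^ (DIM('a) - card J) *
     (\<Sum>h\<in>H_quot L C v J.
        expi \<sigma> (frac_weight v d J h) * expi \<tau> (u (box_rep v J h)) *
        (\<Prod>i\<in>J. 1 / (1 - expi \<sigma> (d i) * expi \<tau> (u (v i)))))"

definition b_diff ::
  "complex \<Rightarrow> complex \<Rightarrow> 'a::euclidean_space set \<Rightarrow>
   'k set set \<Rightarrow> ('k set \<Rightarrow> 'a set) \<Rightarrow> ('k \<Rightarrow> 'a) \<Rightarrow> ('k \<Rightarrow> real) \<Rightarrow>
   'i set set \<Rightarrow> ('i set \<Rightarrow> 'a set) \<Rightarrow> ('i \<Rightarrow> 'a) \<Rightarrow> ('i \<Rightarrow> real) \<Rightarrow>
   'i set \<Rightarrow> ('a \<Rightarrow> real) \<Rightarrow> complex" where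
  "b_diff \<tau> \<sigma> L \<Sigma>' C' v' d' \<Sigma> C v d J u =
     (\<Sum>J' | J' \<in> \<Sigma>' \<and> carrier_face C' \<Sigma> C J' = J. b_fun \<tau> \<sigma> L C' v' d' J' u)
     - b_fun \<tau> \<sigma> L C v d J u"

definition period_lattice :: "complex \<Rightarrow> complex set" where
  "period_lattice \<tau> = {of_int m + of_int k * \<tau> | m k. True}"

end

theory Submission
  imports Defs
begin

text \<open>Put \<open>\<phi>(w) = \<Sum>i. d i * u_i(w)\<close> and let \<open>\<omega>(w) = \<zeta>^\<phi>(w) q^u(w)\<close>, a character of the
  ambient group. Since \<open>d'\<close> is the pull-back of \<open>d\<close>, every \<open>d' i'\<close> equals \<open>\<phi> (v' i')\<close>, so both kinds
  of functions \<open>b_J\<close> are built from the same \<open>\<omega>\<close>. Up to the common sign \<open>(-1)^n\<close>,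
  \<open>b_J\<close> is the value at \<open>\<omega>\<close> of the rational generating function of the lattice points in
  the negative of the relative interior of \<open>C J\<close>. As the relative interior of \<open>C J\<close> is the disjoint
  union of the relative interiors of the \<open>C' J'\<close> with \<open>\<rho>(J') = J\<close>, the identity
  follows from additivity of these values, which exist even where the series diverge.\<close>

section \<open>Values of formal sums at a character\<close>

text \<open>A function \<open>F\<close> stands for the formal sum of the terms \<open>F w * \<omega> w\<close>. Passing to the differences
  \<open>F w - F (w - a)\<close> multiplies a convergent sum by \<open>1 - \<omega> a\<close>; the second rule makes this a definition
  for sums that become finite after finitely many such steps.\<close>

inductive has_value :: "('a::ab_group_add \<Rightarrow> complex) \<Rightarrow> ('a \<Rightarrow> complex) \<Rightarrow> complex \<Rightarrow> bool"
  for \<omega> where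
  has_value_finite:
    "finite A \<Longrightarrow> {w. F w \<noteq> 0} \<subseteq> A \<Longrightarrow> has_value \<omega> F (\<Sum>w\<in>A. F w * \<omega> w)"
| has_value_shift:
    "\<omega> a \<noteq> 1 \<Longrightarrow> has_value \<omega> (\<lambda>w. F w - F (w - a)) t \<Longrightarrow> has_value \<omega> F (t / (1 - \<omega> a))"

lemma has_value_zero: "has_value \<omega> (\<lambda>w. 0) 0"
  using has_value_finite[of "{}" "\<lambda>w. 0" \<omega>] by simp

lemma has_value_cmult: "has_value \<omega> F s \<Longrightarrow> has_value \<omega> (\<lambda>w. c * F w) (c * s)"
proof (induction rule: has_value.induct)
  case (has_value_finite A F)
  then have "has_value \<omega> (\<lambda>w. c * F w) (\<Sum>w\<in>A. c * F w * \<omega> w)"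
    by (intro has_value.has_value_finite) auto
  then show ?case by (simp add: sum_distrib_left mult.assoc)
next
  case (has_value_shift a F t)
  then show ?case
    using has_value.has_value_shift[of \<omega> a "\<lambda>w. c * F w" "c * t"]
    by (simp add: right_diff_distrib)
qed

text \<open>The zero function stays zero under every difference step, so any derivation for it ends
  in a sum of zero terms. General uniqueness reduces to this case by subtraction.\<close>

lemma has_value_zero_unique: "has_value \<omega> F s \<Longrightarrow> F = (\<lambda>w. 0) \<Longrightarrow> s = 0"
  by (induction rule: has_value.induct) auto

text \<open>Multiplicativity makes translation by \<open>a\<close> act on finite sums as
  multiplication by \<open>\<omega> a\<close>; additivity and uniqueness of values rest on
  it.\<close>

locale character =
  fixes \<omega> :: "'a::ab_group_add \<Rightarrow> complex"
  assumes add: "\<omega> (x + y) = \<omega> x * \<omega> y"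
begin

text \<open>Reindexing the translated terms shows that, for finite sums, a difference step really
  multiplies by \<open>1 - \<omega> a\<close>. The set \<open>B\<close> holds the supports of both
  terms.\<close>

lemma finite_shift:
  fixes a A
  defines "B \<equiv> A \<union> (\<lambda>w. w + a) ` A"
  assumes A: "finite A" and F: "{w. F w \<noteq> 0} \<subseteq> A"
  shows "finite B" and "{w. F w - F (w - a) \<noteq> 0} \<subseteq> B"
    and "(\<Sum>w\<in>B. (F w - F (w - a)) * \<omega> w) = (1 - \<omega> a) * (\<Sum>w\<in>A. F w * \<omega> w)"
proof -
  show B: "finite B" using A by (simp add: B_def)
  have shifted: "F (w - a) = 0" if "w \<notin> (\<lambda>w. w + a) ` A" for w
  proof -
    have "w - a \<notin> A" using that by (metis diff_add_cancel imageI)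
    then show ?thesis using F by auto
  qed
  then show "{w. F w - F (w - a) \<noteq> 0} \<subseteq> B"
    using F by (auto simp: B_def)
  have 1: "(\<Sum>w\<in>B. F w * \<omega> w) = (\<Sum>w\<in>A. F w * \<omega> w)"
    by (rule sum.mono_neutral_right) (use B F in \<open>auto simp: B_def\<close>)
  have "(\<Sum>w\<in>B. F (w - a) * \<omega> w) = (\<Sum>w\<in>(\<lambda>w. w + a) ` A. F (w - a) * \<omega> w)"
    by (rule sum.mono_neutral_right) (use B shifted in \<open>auto simp: B_def\<close>)
  also have "\<dots> = (\<Sum>w\<in>A. F w * \<omega> w) * \<omega> a"
    by (subst sum.reindex) (auto simp: inj_on_def add sum_distrib_right mult.assoc)
  finally show "(\<Sum>w\<in>B. (F w - F (w - a)) * \<omega> w) = (1 - \<omega> a) * (\<Sum>w\<in>A. F w * \<omega> w)"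
    using 1 by (simp only: left_diff_distrib sum_subtractf mult_1 mult.commute[of "\<omega> a"])
qed

text \<open>Difference operators in two directions commute, so a step by \<open>a\<close> can be
  carried through a derivation made of steps by other vectors. Nothing is divided here, so
  \<open>\<omega> a = 1\<close> is allowed.\<close>

lemma has_value_shift_diff:
  "has_value \<omega> F s \<Longrightarrow> has_value \<omega> (\<lambda>w. F w - F (w - a)) ((1 - \<omega> a) * s)"
proof (induction rule: has_value.induct)
  case (has_value_finite A F)
  have "has_value \<omega> (\<lambda>w. F w - F (w - a))
          (\<Sum>w\<in>A \<union> (\<lambda>w. w + a) ` A. (F w - F (w - a)) * \<omega> w)"
    by (intro has_value.has_value_finite finite_shift[OF has_value_finite])
  then show ?case by (simp only: finite_shift(3)[OF has_value_finite])
next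
  case (has_value_shift b F t)
  have "(\<lambda>w. F w - F (w - b) - (F (w - a) - F (w - a - b))) =
        (\<lambda>w. F w - F (w - a) - (F (w - b) - F (w - b - a)))"
    by (simp add: fun_eq_iff diff_diff_eq add.commute)
  then show ?case
    using has_value.has_value_shift[of \<omega> b "\<lambda>w. F w - F (w - a)" "(1 - \<omega> a) * t"]
      has_value_shift by simp
qed

text \<open>Induction on the derivation for \<open>G\<close>. Each step also replaces
  \<open>F\<close> by its difference, again finitely supported, so \<open>F\<close> and
  \<open>A\<close> must vary; the final division removes the factor this introduces.\<close>

lemma has_value_add_finite:
  assumes "has_value \<omega> G t" "finite A" "{w. F w \<noteq> 0} \<subseteq> A"
  shows "has_value \<omega> (\<lambda>w. F w + G w) ((\<Sum>w\<in>A. F w * \<omega> w) + t)"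
  using assms
proof (induction arbitrary: F A rule: has_value.induct)
  case (has_value_finite B G)
  have "(\<Sum>w\<in>A \<union> B. F w * \<omega> w) = (\<Sum>w\<in>A. F w * \<omega> w)"
    by (rule sum.mono_neutral_right) (use has_value_finite in auto)
  moreover have "(\<Sum>w\<in>A \<union> B. G w * \<omega> w) = (\<Sum>w\<in>B. G w * \<omega> w)"
    by (rule sum.mono_neutral_right) (use has_value_finite in auto)
  moreover have "has_value \<omega> (\<lambda>w. F w + G w) (\<Sum>w\<in>A \<union> B. (F w + G w) * \<omega> w)"
    by (rule has_value.has_value_finite) (use has_value_finite in force)+
  ultimately show ?case by (simp add: distrib_right sum.distrib)
next
  case (has_value_shift a G t)
  have "has_value \<omega> (\<lambda>w. F w + G w - (F (w - a) + G (w - a)))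
          ((1 - \<omega> a) * (\<Sum>w\<in>A. F w * \<omega> w) + t)"
    using has_value_shift.IH[OF finite_shift(1,2)[OF has_value_shift.prems, where a = a]]
    by (simp only: finite_shift(3)[OF has_value_shift.prems] add_diff_add)
  from has_value.has_value_shift[of \<omega> a "\<lambda>w. F w + G w", OF has_value_shift.hyps(1) this]
  show ?case using has_value_shift.hyps(1) by (simp add: add_divide_distrib)
qed

text \<open>The two derivations may use different directions. The one for \<open>F\<close> is
  followed, and \<open>G\<close> is carried along by \<open>has_value_shift_diff\<close> until
  \<open>F\<close> has become finite.\<close>

lemma has_value_add:
  assumes "has_value \<omega> F s" "has_value \<omega> G t"
  shows "has_value \<omega> (\<lambda>w. F w + G w) (s + t)"
  using assms
proof (induction arbitrary: G t rule: has_value.induct)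
  case (has_value_finite A F)
  then show ?case by (intro has_value_add_finite) auto
next
  case (has_value_shift a F s)
  have "has_value \<omega> (\<lambda>w. F w + G w - (F (w - a) + G (w - a))) (s + (1 - \<omega> a) * t)"
    using has_value_shift.IH[OF has_value_shift_diff[OF has_value_shift.prems, of a]]
    by (simp only: add_diff_add)
  from has_value.has_value_shift[of \<omega> a "\<lambda>w. F w + G w", OF has_value_shift.hyps(1) this]
  show ?case using has_value_shift.hyps(1) by (simp add: add_divide_distrib)
qed

lemma has_value_sum:
  assumes "finite X" "\<And>x. x \<in> X \<Longrightarrow> has_value \<omega> (F x) (s x)"
  shows "has_value \<omega> (\<lambda>w. \<Sum>x\<in>X. F x w) (\<Sum>x\<in>X. s x)"
  using assms
  by (induction X rule: finite_induct) (auto simp: has_value_zero intro: has_value_add)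

text \<open>Two values of \<open>F\<close> would give the zero function the value
  \<open>s - t\<close>.\<close>

lemma has_value_unique:
  assumes "has_value \<omega> F s" "has_value \<omega> F t"
  shows "s = t"
proof -
  have "has_value \<omega> (\<lambda>w. F w + (- 1) * F w) (s + (- 1) * t)"
    by (intro has_value_add has_value_cmult assms)
  from has_value_zero_unique[OF this] show ?thesis by simp
qed

end

section \<open>Coordinates, cones and lattices\<close>

text \<open>Abstracts the edge vectors of one simplicial cone. Injectivity lets coordinates be
  indexed by vertices instead of vectors.\<close>

locale indep_family =
  fixes v :: "'k \<Rightarrow> 'a::euclidean_space" and J :: "'k set"
  assumes fin: "finite J" and inj: "inj_on v J" and indep: "independent (v ` J)"
begin

abbreviation coord :: "'k \<Rightarrow> 'a \<Rightarrow> real" where "coord \<equiv> dual_coord v J"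

lemma in_span: "j \<in> J \<Longrightarrow> v j \<in> span (v ` J)"
  by (simp add: span_base)

lemma combination_in_span: "(\<Sum>j\<in>J. c j *\<^sub>R v j) \<in> span (v ` J)"
  by (intro span_sum span_scale in_span)

lemma coord_add:
  "x \<in> span (v ` J) \<Longrightarrow> y \<in> span (v ` J) \<Longrightarrow> coord i (x + y) = coord i x + coord i y"
  by (simp add: dual_coord_def representation_add indep)

lemma coord_diff:
  "x \<in> span (v ` J) \<Longrightarrow> y \<in> span (v ` J) \<Longrightarrow> coord i (x - y) = coord i x - coord i y"
  by (simp add: dual_coord_def representation_diff indep)

lemma coord_minus: "x \<in> span (v ` J) \<Longrightarrow> coord i (- x) = - coord i x"
  by (simp add: dual_coord_def representation_neg indep)

lemma coord_scaleR: "x \<in> span (v ` J) \<Longrightarrow> coord i (c *\<^sub>R x) = c * coord i x"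
  by (simp add: dual_coord_def representation_scale indep)

lemma coord_zero: "coord i 0 = 0"
  by (simp add: dual_coord_def representation_zero)

lemma coord_basis: "i \<in> J \<Longrightarrow> j \<in> J \<Longrightarrow> coord i (v j) = (if i = j then 1 else 0)"
  using inj by (auto simp: dual_coord_def representation_basis indep inj_on_def)

lemma expansion: "x \<in> span (v ` J) \<Longrightarrow> (\<Sum>j\<in>J. coord j x *\<^sub>R v j) = x"
  using sum_representation_eq[OF indep _ finite_imageI[OF fin] order_refl, of x]
  by (simp add: dual_coord_def sum.reindex inj)

lemma coord_sum:
  "(\<And>x. x \<in> X \<Longrightarrow> g x \<in> span (v ` J)) \<Longrightarrow> coord i (sum g X) = (\<Sum>x\<in>X. coord i (g x))"
  by (simp add: dual_coord_def representation_sum indep)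

lemma coord_combination:
  assumes "i \<in> J"
  shows "coord i (\<Sum>j\<in>J. c j *\<^sub>R v j) = c i"
proof -
  have "coord i (\<Sum>j\<in>J. c j *\<^sub>R v j) = (\<Sum>j\<in>J. c j * (if i = j then 1 else 0))"
    using assms by (simp add: coord_sum coord_scaleR coord_basis in_span span_scale)
  then show ?thesis using assms fin by (simp add: if_distrib[of "(*) _"] cong: if_cong)
qed

lemma coord_eqI:
  assumes "x \<in> span (v ` J)" "y \<in> span (v ` J)" "\<And>j. j \<in> J \<Longrightarrow> coord j x = coord j y"
  shows "x = y"
  using expansion[OF assms(1)] expansion[OF assms(2)] assms(3) by (metis (no_types, lifting) sum.cong)

lemma linear_by_coord:
  assumes "linear f" "x \<in> span (v ` J)"
  shows "f x = (\<Sum>j\<in>J. f (v j) * coord j x)"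
proof -
  have "f x = f (\<Sum>j\<in>J. coord j x *\<^sub>R v j)" using assms expansion by simp
  also have "\<dots> = (\<Sum>j\<in>J. f (v j) * coord j x)"
    using assms by (simp add: linear_sum linear_scale mult.commute)
  finally show ?thesis .
qed

text \<open>Vectors with nonnegative coordinates form a convex cone containing the generators, which
  bounds the hull from above; conversely, the basis expansion builds such a vector from generators
  by scaling and adding.\<close>

lemma mem_convex_cone_hull_iff:
  "x \<in> convex_cone hull (v ` J) \<longleftrightarrow> x \<in> span (v ` J) \<and> (\<forall>j\<in>J. 0 \<le> coord j x)"
proof
  let ?S = "{x \<in> span (v ` J). \<forall>j\<in>J. 0 \<le> coord j x}"
  have "convex_cone ?S"
    by (auto simp: convex_cone_iff span_zero coord_zero span_add coord_add span_scale coord_scaleR)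
  then have "convex_cone hull (v ` J) \<subseteq> ?S"
    by (intro hull_minimal) (auto simp: in_span coord_basis)
  then show "x \<in> span (v ` J) \<and> (\<forall>j\<in>J. 0 \<le> coord j x)" if "x \<in> convex_cone hull (v ` J)"
    using that by auto
next
  let ?K = "convex_cone hull (v ` J)"
  assume *: "x \<in> span (v ` J) \<and> (\<forall>j\<in>J. 0 \<le> coord j x)"
  have "(\<Sum>j\<in>X. coord j x *\<^sub>R v j) \<in> ?K" if "finite X" "X \<subseteq> J" for X
    using that
  proof (induction X rule: finite_induct)
    case empty
    then show ?case by (simp add: convex_cone_hull_contains_0)
  next
    case (insert k X)
    then show ?case
      using * by (auto intro!: convex_cone_hull_add convex_cone_hull_mul[OF hull_inc])
  qed
  from this[OF fin order_refl] show "x \<in> ?K" using expansion * by simp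
qed

lemma span_convex_cone_hull: "span (convex_cone hull (v ` J)) = span (v ` J)"
proof
  show "span (convex_cone hull (v ` J)) \<subseteq> span (v ` J)"
    by (rule span_minimal) (auto simp: mem_convex_cone_hull_iff)
  show "span (v ` J) \<subseteq> span (convex_cone hull (v ` J))"
    by (intro span_mono hull_subset)
qed

lemma subfamily: "K \<subseteq> J \<Longrightarrow> indep_family v K"
  using finite_subset[OF _ fin] inj_on_subset[OF inj] independent_mono[OF indep image_mono]
  by (simp add: indep_family_def)

text \<open>The expansion over \<open>K\<close> is also an expansion over \<open>J\<close>, with
  zero coefficients off \<open>K\<close>.\<close>

lemma coord_subfamily:
  assumes "K \<subseteq> J" "x \<in> span (v ` K)" "i \<in> J"
  shows "coord i x = (if i \<in> K then dual_coord v K i x else 0)"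
proof -
  interpret K: indep_family v K using assms subfamily by blast
  have "coord i x = coord i (\<Sum>j\<in>K. K.coord j x *\<^sub>R v j)"
    using K.expansion assms by simp
  also have "\<dots> = (\<Sum>j\<in>K. K.coord j x * (if i = j then 1 else 0))"
    using assms
    by (subst coord_sum) (auto simp: coord_scaleR coord_basis in_span span_scale subset_iff intro!: sum.cong)
  finally show ?thesis
    using K.fin by (simp add: if_distrib[of "(*) _"] cong: if_cong)
qed

lemma span_subfamily_iff:
  assumes "K \<subseteq> J"
  shows "x \<in> span (v ` K) \<longleftrightarrow> x \<in> span (v ` J) \<and> (\<forall>i\<in>J - K. coord i x = 0)"
proof
  assume "x \<in> span (v ` K)"
  then show "x \<in> span (v ` J) \<and> (\<forall>i\<in>J - K. coord i x = 0)"
    using assms span_mono[OF image_mono[OF assms]] coord_subfamily[OF assms] by auto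
next
  assume *: "x \<in> span (v ` J) \<and> (\<forall>i\<in>J - K. coord i x = 0)"
  then have "x = (\<Sum>j\<in>K. coord j x *\<^sub>R v j)"
    by (subst expansion[symmetric]) (auto intro!: sum.mono_neutral_right fin assms)
  then show "x \<in> span (v ` K)"
    by (metis (no_types, lifting) imageI span_base span_scale span_sum)
qed

text \<open>On the span of the subfamily both coordinate systems agree on \<open>K\<close>; outside
  that span both sides fail.\<close>

lemma mem_subcone_iff:
  assumes "K \<subseteq> J"
  shows "x \<in> convex_cone hull (v ` K) \<longleftrightarrow>
    x \<in> convex_cone hull (v ` J) \<and> (\<forall>i\<in>J - K. coord i x = 0)"
proof -
  interpret K: indep_family v K using assms subfamily by blast
  show ?thesis
  proof (cases "x \<in> span (v ` K)")
    case True
    then have "coord i x = (if i \<in> K then K.coord i x else 0)" if "i \<in> J" for i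
      using coord_subfamily assms that by blast
    then show ?thesis
      using True span_subfamily_iff[OF assms, of x] assms
      unfolding mem_convex_cone_hull_iff K.mem_convex_cone_hull_iff by (auto simp: subset_iff)
  next
    case False
    then show ?thesis
      using span_subfamily_iff[OF assms, of x]
      unfolding mem_convex_cone_hull_iff K.mem_convex_cone_hull_iff by blast
  qed
qed

end

section \<open>Lattices as discrete subgroups\<close>

lemma int_spanI: "x = (\<Sum>b\<in>B. of_int (c b) *\<^sub>R b) \<Longrightarrow> x \<in> int_span B"
  unfolding int_span_def by auto

lemma lattice_diff:
  assumes "is_lattice L" "x \<in> L" "y \<in> L" shows "x - y \<in> L"
proof -
  obtain B where L: "L = int_span B" using assms by (auto simp: is_lattice_def)
  obtain a b where "x = (\<Sum>w\<in>B. of_int (a w) *\<^sub>R w)" "y = (\<Sum>w\<in>B. of_int (b w) *\<^sub>R w)"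
    using assms unfolding L int_span_def by auto
  then have "x - y = (\<Sum>w\<in>B. of_int (a w - b w) *\<^sub>R w)"
    by (simp add: scaleR_left_diff_distrib sum_subtractf)
  then show ?thesis unfolding L by (rule int_spanI)
qed

lemma lattice_zero:
  assumes "is_lattice L" shows "0 \<in> L"
proof -
  obtain B where L: "L = int_span B" using assms by (auto simp: is_lattice_def)
  have "0 = (\<Sum>w\<in>B. of_int 0 *\<^sub>R w)" by simp
  then show ?thesis unfolding L by (rule int_spanI)
qed

lemma lattice_uminus: "is_lattice L \<Longrightarrow> x \<in> L \<Longrightarrow> - x \<in> L"
  using lattice_diff[of L 0 x] lattice_zero[of L] by simp

lemma lattice_add: "is_lattice L \<Longrightarrow> x \<in> L \<Longrightarrow> y \<in> L \<Longrightarrow> x + y \<in> L"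
  using lattice_diff[of L x "- y"] lattice_uminus[of L y] by simp

lemma lattice_scale_int:
  assumes "is_lattice L" "x \<in> L" shows "of_int m *\<^sub>R x \<in> L"
proof -
  obtain B where L: "L = int_span B" using assms by (auto simp: is_lattice_def)
  obtain a where "x = (\<Sum>w\<in>B. of_int (a w) *\<^sub>R w)"
    using assms unfolding L int_span_def by auto
  then have "of_int m *\<^sub>R x = (\<Sum>w\<in>B. of_int (m * a w) *\<^sub>R w)"
    by (simp add: scaleR_sum_right)
  then show ?thesis unfolding L by (rule int_spanI)
qed

lemma lattice_sum:
  assumes "is_lattice L" "\<And>x. x \<in> X \<Longrightarrow> g x \<in> L" shows "sum g X \<in> L"
  using assms(2)
  by (induction X rule: infinite_finite_induct) (auto intro: lattice_zero lattice_add assms(1))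

text \<open>Coordinates in a lattice basis are bounded linear forms, hence bounded on
  \<open>S\<close>; on lattice points they are integers, which leaves finitely many coefficient
  vectors.\<close>

lemma finite_lattice_bounded:
  fixes L :: "'a::euclidean_space set"
  assumes "is_lattice L" "bounded S"
  shows "finite (L \<inter> S)"
proof -
  obtain B where B: "independent B" "span B = UNIV" and L: "L = int_span B"
    using assms by (auto simp: is_lattice_def)
  have fB: "finite B" using B independent_imp_finite by blast
  have lin: "linear (\<lambda>x. representation B x b)" for b
    by (rule linearI) (auto simp: representation_add representation_scale B)
  obtain M where M: "\<And>x. x \<in> S \<Longrightarrow> norm x \<le> M" using assms bounded_iff by blast
  have "\<exists>K. \<forall>x\<in>S. \<bar>representation B x b\<bar> \<le> K" for b
  proof -
    have "bounded_linear (\<lambda>x. representation B x b)"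
      using lin linear_conv_bounded_linear by blast
    then obtain N where "\<And>x. norm (representation B x b) \<le> norm x * N" "N > 0"
      using bounded_linear.pos_bounded by blast
    then show ?thesis using M by (intro exI[of _ "M * N"]) (smt (verit) mult_right_mono real_norm_def)
  qed
  then obtain K where K: "\<And>b x. x \<in> S \<Longrightarrow> \<bar>representation B x b\<bar> \<le> K b" by metis
  \<comment> \<open>Coefficient functions are taken extensional on \<open>B\<close>, so that only
    their finitely many values there count.\<close>
  let ?P = "PiE B (\<lambda>b. {m::int. \<bar>of_int m\<bar> \<le> K b})"
  have "finite {m::int. \<bar>of_int m\<bar> \<le> k}" for k :: real
  proof (rule finite_subset)
    show "{m::int. \<bar>of_int m\<bar> \<le> k} \<subseteq> {- \<lfloor>k\<rfloor>..\<lfloor>k\<rfloor>}"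
      by (auto simp: abs_le_iff le_floor_iff) (smt (verit) le_floor_iff of_int_minus)
  qed simp
  then have fP: "finite ?P" using fB by (simp add: finite_PiE)
  have "L \<inter> S \<subseteq> (\<lambda>c. \<Sum>b\<in>B. of_int (c b) *\<^sub>R b) ` ?P"
  proof
    fix x assume x: "x \<in> L \<inter> S"
    then obtain c where c: "x = (\<Sum>b\<in>B. of_int (c b) *\<^sub>R b)"
      unfolding L int_span_def by auto
    have "representation B x b = of_int (c b)" if "b \<in> B" for b
    proof -
      interpret indep_family "\<lambda>x. x" B by unfold_locales (auto simp: fB B)
      show ?thesis using coord_combination[OF that, of "\<lambda>b. of_int (c b)"] c
        by (simp add: dual_coord_def)
    qed
    then have "\<bar>of_int (c b)\<bar> \<le> K b" if "b \<in> B" for b using K x that by (metis IntE)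
    then have "restrict c B \<in> ?P" by auto
    moreover have "x = (\<Sum>b\<in>B. of_int (restrict c B b) *\<^sub>R b)" unfolding c by (rule sum.cong) auto
    ultimately show "x \<in> (\<lambda>c. \<Sum>b\<in>B. of_int (c b) *\<^sub>R b) ` ?P" by blast
  qed
  then show ?thesis using fP finite_surj by blast
qed

section \<open>Half-open boxes and generating functions of open cones\<close>

context indep_family
begin

text \<open>The lattice points of the fundamental parallelepiped: these are the representatives
  \<open>v_{J,h}\<close> of the classes in \<open>H_J\<close>.\<close>

definition half_open_box :: "'a set \<Rightarrow> 'a set" where
  "half_open_box L = {w \<in> L \<inter> span (v ` J). \<forall>j\<in>J. 0 \<le> coord j w \<and> coord j w < 1}"

text \<open>The relative interior of the generated cone, in coordinates. For empty \<open>J\<close>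
  it is the origin, not the empty set.\<close>

definition open_cone :: "'a set" where
  "open_cone = {w \<in> span (v ` J). \<forall>j\<in>J. 0 < coord j w}"

lemma int_span_iff: "x \<in> int_span (v ` J) \<longleftrightarrow> x \<in> span (v ` J) \<and> (\<forall>j\<in>J. coord j x \<in> \<int>)"
proof
  assume "x \<in> int_span (v ` J)"
  then obtain c where "x = (\<Sum>b\<in>v ` J. of_int (c b) *\<^sub>R b)" by (auto simp: int_span_def)
  then have "x = (\<Sum>j\<in>J. of_int (c (v j)) *\<^sub>R v j)" by (simp add: sum.reindex inj)
  then show "x \<in> span (v ` J) \<and> (\<forall>j\<in>J. coord j x \<in> \<int>)"
    using combination_in_span[of "\<lambda>j. of_int (c (v j))"] by (simp add: coord_combination)
next
  assume *: "x \<in> span (v ` J) \<and> (\<forall>j\<in>J. coord j x \<in> \<int>)"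
  \<comment> \<open>Floors supply the total integer-valued coefficient function that
    \<open>int_span\<close> asks for; on \<open>J\<close> they change nothing, as the coordinates
    are integral.\<close>
  have "x = (\<Sum>j\<in>J. of_int \<lfloor>coord j x\<rfloor> *\<^sub>R v j)"
    using * by (subst expansion[symmetric]) (auto intro!: sum.cong)
  also have "\<dots> = (\<Sum>b\<in>v ` J. of_int \<lfloor>representation (v ` J) x b\<rfloor> *\<^sub>R b)"
    by (simp add: sum.reindex inj dual_coord_def)
  finally show "x \<in> int_span (v ` J)" by (rule int_spanI)
qed

lemma finite_half_open_box:
  assumes "is_lattice L" shows "finite (half_open_box L)"
proof -
  let ?S = "{w \<in> span (v ` J). \<forall>j\<in>J. 0 \<le> coord j w \<and> coord j w < 1}"
  have "norm w \<le> (\<Sum>j\<in>J. norm (v j))" if "w \<in> ?S" for w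
  proof -
    have "norm w = norm (\<Sum>j\<in>J. coord j w *\<^sub>R v j)" using that expansion by simp
    also have "\<dots> \<le> (\<Sum>j\<in>J. norm (v j))"
      by (rule sum_norm_le) (use that in \<open>auto intro!: mult_left_le_one_le\<close>)
    finally show ?thesis .
  qed
  then have "bounded ?S" unfolding bounded_iff by blast
  then have "finite (L \<inter> ?S)" using assms finite_lattice_bounded by blast
  moreover have "half_open_box L = L \<inter> ?S" by (auto simp: half_open_box_def)
  ultimately show ?thesis by simp
qed

text \<open>Every coset meets the box exactly once: reducing coordinates to their fractional parts
  gives a point, and two points of the box with integral coordinate differences coincide. Hence the
  sum over classes becomes a sum over lattice points.\<close>

lemma sum_H_quot:
  assumes L: "is_lattice L" and vL: "v ` J \<subseteq> L" and C: "span (C J) = span (v ` J)"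
  shows "(\<Sum>h\<in>H_quot L C v J. g (box_rep v J h)) = sum g (half_open_box L)"
proof (rule sum.reindex_bij_betw)
  define M where "M = L \<inter> span (v ` J)"
  \<comment> \<open>The congruence modulo the sublattice generated by the edge vectors, rewritten in
    coordinates.\<close>
  define R where "R = {(x, y). x \<in> M \<and> y \<in> M \<and> (\<forall>j\<in>J. coord j x - coord j y \<in> \<int>)}"
  have H: "H_quot L C v J = M // R"
    unfolding H_quot_def face_lattice_def C M_def R_def
    by (rule arg_cong[where f = "\<lambda>r. _ // r"]) (auto simp: int_span_iff coord_diff span_diff)
  have box_M: "w \<in> M" if "w \<in> half_open_box L" for w using that by (auto simp: half_open_box_def M_def)
  have "equiv M R"
  proof (rule equivI)
    show "R \<subseteq> M \<times> M" by (auto simp: R_def)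
    show "refl_on M R" by (auto simp: refl_on_def R_def)
    show "sym R" unfolding sym_def R_def using Ints_minus by fastforce
    show "trans R" unfolding trans_def R_def using Ints_add by fastforce
  qed
  then have cls_eq: "R `` {x} = R `` {y}" if "(x, y) \<in> R" for x y
    using that by (rule equiv_class_eq)
  have rep: "box_rep v J (R `` {w}) = w" if w: "w \<in> half_open_box L" for w
    unfolding box_rep_def
  proof (rule the_equality)
    show "w \<in> R `` {w} \<and> (\<forall>i\<in>J. 0 \<le> coord i w \<and> coord i w < 1)"
      using w box_M[OF w] by (auto simp: R_def half_open_box_def)
    fix y assume y: "y \<in> R `` {w} \<and> (\<forall>i\<in>J. 0 \<le> coord i y \<and> coord i y < 1)"
    show "y = w"
    proof (rule coord_eqI)
      show "y \<in> span (v ` J)" "w \<in> span (v ` J)" using y w by (auto simp: R_def M_def half_open_box_def)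
      fix j assume j: "j \<in> J"
      then have "coord j w - coord j y \<in> \<int>" using y by (auto simp: R_def)
      then obtain m where m: "coord j w - coord j y = of_int m" by (auto elim: Ints_cases)
      moreover have "\<bar>coord j w - coord j y\<bar> < 1"
        using y w j unfolding half_open_box_def by (smt (verit) mem_Collect_eq)
      ultimately have "m = 0" by linarith
      then show "coord j y = coord j w" using m by simp
    qed
  qed
  have ex: "\<exists>w\<in>half_open_box L. h = R `` {w}" if "h \<in> M // R" for h
  proof -
    obtain x where x: "x \<in> M" "h = R `` {x}" using \<open>h \<in> M // R\<close> by (rule quotientE)
    \<comment> \<open>The integral part of \<open>x\<close>, a lattice vector because the edge
      vectors lie in \<open>L\<close>; \<open>x - s\<close> is the box point congruent to
      \<open>x\<close>.\<close>
    define s where "s = (\<Sum>j\<in>J. of_int \<lfloor>coord j x\<rfloor> *\<^sub>R v j)"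
    have s: "s \<in> L" unfolding s_def
      by (intro lattice_sum lattice_scale_int) (use L vL in auto)
    have s': "s \<in> span (v ` J)" "\<And>j. j \<in> J \<Longrightarrow> coord j s = of_int \<lfloor>coord j x\<rfloor>"
      unfolding s_def by (rule combination_in_span) (rule coord_combination)
    have "coord j (x - s) = frac (coord j x)" if "j \<in> J" for j
      using s' that x by (simp add: coord_diff M_def frac_def)
    then have "x - s \<in> half_open_box L"
      using x s s' L by (auto simp: half_open_box_def M_def span_diff lattice_diff frac_ge_0 frac_lt_1)
    moreover have "(x, x - s) \<in> R"
      using box_M[OF calculation] x s' by (auto simp: R_def M_def coord_diff)
    ultimately show ?thesis using x cls_eq by blast
  qed
  show "bij_betw (box_rep v J) (H_quot L C v J) (half_open_box L)"
    unfolding H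
  proof (rule bij_betw_byWitness[where f' = "\<lambda>w. R `` {w}"])
    show "\<forall>h\<in>M // R. R `` {box_rep v J h} = h" using ex rep by metis
    show "\<forall>w\<in>half_open_box L. box_rep v J (R `` {w}) = w" using rep by blast
    show "box_rep v J ` (M // R) \<subseteq> half_open_box L" using ex rep by force
    show "(\<lambda>w. R `` {w}) ` half_open_box L \<subseteq> M // R" using box_M by (auto intro: quotientI)
  qed
qed

text \<open>The negative cone is used because one difference step by \<open>v j\<close> turns \<open>coord j w < 0\<close> into
  \<open>0 \<le> coord j w < 1\<close> with a minus sign: this is the half-open box of \<open>b_J\<close>, with the right sign and
  without inverting \<open>\<omega>\<close>.\<close>

lemma has_value_neg_open_cone:
  assumes L: "is_lattice L" and vL: "v ` J \<subseteq> L" and "character \<omega>"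
    and ne: "\<And>j. j \<in> J \<Longrightarrow> \<omega> (v j) \<noteq> 1"
  shows "has_value \<omega> (indicator {w \<in> L. - w \<in> open_cone})
           ((- 1) ^ card J * (\<Sum>w\<in>half_open_box L. \<omega> w * (\<Prod>j\<in>J. 1 / (1 - \<omega> (v j)))))"
proof -
  \<comment> \<open>Interpolates between the half-open box \<open>S {}\<close> and the negative open
    cone \<open>S J\<close>; the induction frees one coordinate at a time.\<close>
  define S where "S K = {w \<in> L \<inter> span (v ` J).
    (\<forall>j\<in>K. coord j w < 0) \<and> (\<forall>j\<in>J - K. 0 \<le> coord j w \<and> coord j w < 1)}" for K
  have val: "has_value \<omega> (indicator (S K))
          ((- 1) ^ card K * (\<Sum>w\<in>half_open_box L. \<omega> w) * (\<Prod>j\<in>K. 1 / (1 - \<omega> (v j))))"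
    if "finite K" "K \<subseteq> J" for K
    using that
  proof (induction K rule: finite_induct)
    case empty
    have "has_value \<omega> (indicator (S {})) (\<Sum>w\<in>half_open_box L. indicator (S {}) w * \<omega> w)"
      using finite_half_open_box[OF L]
      by (intro has_value_finite) (auto simp: S_def half_open_box_def indicator_def)
    also have "(\<Sum>w\<in>half_open_box L. indicator (S {}) w * \<omega> w) = (\<Sum>w\<in>half_open_box L. \<omega> w)"
      by (rule sum.cong) (auto simp: S_def half_open_box_def)
    finally show ?case by simp
  next
    case (insert k K)
    have k: "k \<in> J" "v k \<in> L" "v k \<in> span (v ` J)" using insert vL in_span by auto
    have shift: "w - v k \<in> L \<inter> span (v ` J) \<longleftrightarrow> w \<in> L \<inter> span (v ` J)" for w
      using k L lattice_diff[of L w "v k"] lattice_add[of L "w - v k" "v k"]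
        span_add[of "w - v k" _ "v k"] span_diff[of w _ "v k"] by auto
    have coord: "coord j (w - v k) = (if j = k then coord j w - 1 else coord j w)"
      if "w \<in> L \<inter> span (v ` J)" "j \<in> J" for j w
      using that k by (auto simp: coord_diff coord_basis)
    \<comment> \<open>The translation lowers only coordinate \<open>k\<close>, by one. The condition
      \<open>coord k w < 1\<close> then splits into \<open>coord k w < 0\<close> and
      \<open>0 \<le> coord k w < 1\<close>, the two alternatives on the right.\<close>
    have "w - v k \<in> S (insert k K) \<longleftrightarrow> w \<in> S (insert k K) \<or> w \<in> S K" for w
    proof (cases "w \<in> L \<inter> span (v ` J)")
      case True
      have "(\<forall>j\<in>K. coord j (w - v k) < 0) \<longleftrightarrow> (\<forall>j\<in>K. coord j w < 0)"
        using coord[OF True] insert.hyps insert.prems by (intro ball_cong) (auto simp: subset_iff)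
      moreover have "(\<forall>j\<in>J - insert k K. 0 \<le> coord j (w - v k) \<and> coord j (w - v k) < 1) \<longleftrightarrow>
          (\<forall>j\<in>J - insert k K. 0 \<le> coord j w \<and> coord j w < 1)"
        using coord[OF True] by (intro ball_cong) auto
      moreover have "J - K = insert k (J - insert k K)" using k insert.hyps by auto
      moreover have "coord k (w - v k) < 0 \<longleftrightarrow> coord k w < 0 \<or> 0 \<le> coord k w \<and> coord k w < 1"
        using coord[OF True k(1)] by auto
      ultimately show ?thesis
        using True shift[of w] unfolding S_def by simp blast
    next
      case False
      then show ?thesis using shift[of w] unfolding S_def by blast
    qed
    moreover have "\<not> (w \<in> S (insert k K) \<and> w \<in> S K)" for w
    proof -
      have "k \<in> J - K" using k insert.hyps by blast
      then show ?thesis unfolding S_def by (smt (verit) insertI1 mem_Collect_eq)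
    qed
    \<comment> \<open>Since the two alternatives are disjoint, the difference is minus the indicator
      of \<open>S K\<close>; each direction thus contributes one sign and one factor
      \<open>1 / (1 - \<omega> (v k))\<close>.\<close>
    ultimately have "(\<lambda>w. indicator (S (insert k K)) w - indicator (S (insert k K)) (w - v k))
        = (\<lambda>w. - 1 * (indicator (S K) w :: complex))"
      by (fastforce simp: indicator_def)
    moreover have "has_value \<omega> (\<lambda>w. - 1 * indicator (S K) w)
        (- 1 * ((- 1) ^ card K * (\<Sum>w\<in>half_open_box L. \<omega> w) * (\<Prod>j\<in>K. 1 / (1 - \<omega> (v j)))))"
      using insert by (intro has_value_cmult) auto
    ultimately have "has_value \<omega> (indicator (S (insert k K)))
        (- 1 * ((- 1) ^ card K * (\<Sum>w\<in>half_open_box L. \<omega> w) * (\<Prod>j\<in>K. 1 / (1 - \<omega> (v j)))) / (1 - \<omega> (v k)))"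
      by (intro has_value_shift ne k) simp
    then show ?case using insert.hyps by (simp add: mult_ac)
  qed
  have neg: "- w \<in> span (v ` J) \<longleftrightarrow> w \<in> span (v ` J)" for w
    using span_neg[of w] span_neg[of "- w"] by auto
  have "S J = {w \<in> L. - w \<in> open_cone}"
    by (auto simp: S_def open_cone_def coord_minus neg)
  then show ?thesis
    using val[OF fin order_refl] by (simp add: sum_distrib_right mult.assoc)
qed

end

section \<open>Faces of simplicial cones\<close>

context
  fixes S F :: "'a::euclidean_space set"
  assumes S: "convex_cone S" and F: "F face_of S"
begin

text \<open>A nonzero \<open>x\<close> is the midpoint of \<open>0\<close> and
  \<open>2 *\<^sub>R x\<close>, both in \<open>S\<close>.\<close>

lemma face_of_cone_zero: "x \<in> F \<Longrightarrow> 0 \<in> F"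
proof (cases "x = 0")
  case False
  assume x: "x \<in> F"
  have "x \<in> open_segment 0 (2 *\<^sub>R x)"
    unfolding in_segment using False by (auto intro!: exI[of _ "1 / 2"])
  moreover have "0 \<in> S" "2 *\<^sub>R x \<in> S"
    using S x face_of_imp_subset[OF F] by (auto intro: convex_cone_contains_0 convex_cone_scaleR)
  ultimately show ?thesis using face_ofD[OF F] x by blast
qed simp

text \<open>Shrinking is convexity together with the origin; for \<open>c > 1\<close> the point
  \<open>x\<close> lies strictly between \<open>0\<close> and its multiple, so the face property
  applies.\<close>

lemma face_of_cone_scaleR:
  assumes "x \<in> F" "0 \<le> c"
  shows "c *\<^sub>R x \<in> F"
proof (cases "x = 0 \<or> c \<le> 1")
  case True
  have "convex F" using F face_of_imp_convex by blast
  then have "(1 - c) *\<^sub>R 0 + c *\<^sub>R x \<in> F" if "c \<le> 1"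
    using that assms face_of_cone_zero by (intro convexD) auto
  then show ?thesis using True assms by auto
next
  case False
  then have "x \<in> open_segment 0 (c *\<^sub>R x)"
    unfolding in_segment by (auto intro!: exI[of _ "1 / c"])
  moreover have "0 \<in> S" "c *\<^sub>R x \<in> S"
    using S assms face_of_imp_subset[OF F] by (auto intro: convex_cone_contains_0 convex_cone_scaleR)
  ultimately show ?thesis using face_ofD[OF F] assms by blast
qed

lemma face_of_cone_convex_cone: "F \<noteq> {} \<Longrightarrow> convex_cone F"
  using face_of_imp_convex[OF F] face_of_cone_scaleR by (auto simp: convex_cone_def conic_def)

text \<open>Half of the sum is the midpoint of \<open>x\<close> and \<open>y\<close>. The case
  \<open>x = y\<close> is separate because the open segment is then empty.\<close>

lemma face_of_cone_summand:
  assumes "x \<in> S" "y \<in> S" "x + y \<in> F"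
  shows "x \<in> F"
proof -
  have half: "(1 / 2) *\<^sub>R (x + y) \<in> F" using face_of_cone_scaleR assms by simp
  show ?thesis
  proof (cases "x = y")
    case True
    then have "(1 / 2) *\<^sub>R (x + y) = x" by (metis scaleR_half_double)
    then show ?thesis using half by simp
  next
    case False
    then have "(1 / 2) *\<^sub>R (x + y) \<in> open_segment x y"
      unfolding in_segment by (auto intro!: exI[of _ "1 / 2"] simp: scaleR_right_distrib)
    then show ?thesis using face_ofD[OF F] half assms by blast
  qed
qed

end

context indep_family
begin

text \<open>Splitting off \<open>coord j x *\<^sub>R v j\<close> leaves a vector of the cone, so
  this summand lies in the face and can be rescaled. \<open>S\<close> is any convex cone around the
  hull, which covers cones of the refinement inside \<open>C I\<close>.\<close>

lemma generator_in_face: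
  assumes S: "convex_cone S" and F: "F face_of S" and sub: "convex_cone hull (v ` J) \<subseteq> S"
    and x: "x \<in> F" "x \<in> convex_cone hull (v ` J)" and j: "j \<in> J" "0 < coord j x"
  shows "v j \<in> F"
proof -
  let ?y = "coord j x *\<^sub>R v j"
  have sp: "x \<in> span (v ` J)" "?y \<in> span (v ` J)"
    using x in_span j by (auto simp: mem_convex_cone_hull_iff span_scale)
  have "?y \<in> convex_cone hull (v ` J)"
    using j by (intro convex_cone_hull_mul hull_inc) auto
  moreover have "x - ?y \<in> convex_cone hull (v ` J)"
    using x j sp unfolding mem_convex_cone_hull_iff
    by (auto simp: span_diff coord_diff coord_scaleR in_span coord_basis)
  ultimately have "?y \<in> F"
    using face_of_cone_summand[OF S F, of ?y "x - ?y"] sub x by auto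
  then have "(1 / coord j x) *\<^sub>R ?y \<in> F"
    by (rule face_of_cone_scaleR[OF S F]) (use j in auto)
  then show ?thesis using j by simp
qed

text \<open>A point of \<open>F\<close> has coordinate zero along each generator outside
  \<open>F\<close>, by \<open>generator_in_face\<close>.\<close>

lemma face_eq_hull:
  assumes F: "F face_of convex_cone hull (v ` J)" "F \<noteq> {}"
  shows "F = convex_cone hull (v ` {j \<in> J. v j \<in> F})"
proof
  have S: "convex_cone (convex_cone hull (v ` J))" by (rule convex_cone_convex_cone_hull)
  show "convex_cone hull (v ` {j \<in> J. v j \<in> F}) \<subseteq> F"
    using face_of_cone_convex_cone[OF S F] by (intro hull_minimal) auto
  show "F \<subseteq> convex_cone hull (v ` {j \<in> J. v j \<in> F})"
  proof
    fix x assume x: "x \<in> F"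
    then have xS: "x \<in> convex_cone hull (v ` J)" using F face_of_imp_subset by blast
    have "coord j x = 0" if "j \<in> J" "v j \<notin> F" for j
      using generator_in_face[OF S F(1) order_refl x xS that(1)] that xS
      by (force simp: mem_convex_cone_hull_iff)
    then show "x \<in> convex_cone hull (v ` {j \<in> J. v j \<in> F})"
      using xS by (subst mem_subcone_iff) auto
  qed
qed

lemma dim_hull: "dim (convex_cone hull (v ` J)) = card J"
  by (metis card_image dim_span dim_span_eq_card_independent indep inj span_convex_cone_hull)

lemma open_cone_subset_hull: "open_cone \<subseteq> convex_cone hull (v ` J)"
  by (auto simp: open_cone_def mem_convex_cone_hull_iff less_imp_le)

text \<open>A simplicial cone is the disjoint union of its relatively open faces: the support of the
  coordinates tells in which one a point lies.\<close>

lemma mem_open_subcone_iff: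
  assumes "K \<subseteq> J"
  shows "x \<in> indep_family.open_cone v K \<longleftrightarrow>
    x \<in> convex_cone hull (v ` J) \<and> K = {j \<in> J. 0 < coord j x}"
proof -
  interpret K: indep_family v K using assms subfamily by blast
  have sub: "coord i x = (if i \<in> K then K.coord i x else 0)" if "x \<in> span (v ` K)" "i \<in> J" for i
    using coord_subfamily assms that by blast
  show ?thesis
  proof
    assume "x \<in> K.open_cone"
    then have x: "x \<in> span (v ` K)" and pos: "\<And>j. j \<in> K \<Longrightarrow> 0 < K.coord j x"
      by (auto simp: K.open_cone_def)
    have "x \<in> convex_cone hull (v ` J)"
      using \<open>x \<in> K.open_cone\<close> K.open_cone_subset_hull mem_subcone_iff[OF assms] by blast
    moreover have "j \<in> K \<longleftrightarrow> 0 < coord j x" if "j \<in> J" for j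
      using sub[OF x that] pos by simp
    ultimately show "x \<in> convex_cone hull (v ` J) \<and> K = {j \<in> J. 0 < coord j x}"
      using assms by blast
  next
    assume x: "x \<in> convex_cone hull (v ` J) \<and> K = {j \<in> J. 0 < coord j x}"
    then have zero: "coord j x = 0" if "j \<in> J - K" for j
      using that by (auto simp: mem_convex_cone_hull_iff order.order_iff_strict)
    have xK: "x \<in> span (v ` K)"
      unfolding span_subfamily_iff[OF assms] using x zero mem_convex_cone_hull_iff by blast
    moreover have "0 < K.coord j x" if "j \<in> K" for j
    proof -
      have "j \<in> J" "0 < coord j x" using x that by blast+
      then show ?thesis using sub[OF xK, of j] that by simp
    qed
    ultimately show "x \<in> K.open_cone" by (simp add: K.open_cone_def)
  qed
qed

text \<open>A relative interior point has all coordinates positive, so a face through it contains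
  every generator.\<close>

lemma hull_subset_face:
  assumes "convex_cone S" "F face_of S" "convex_cone hull (v ` J) \<subseteq> S" "x \<in> F" "x \<in> open_cone"
  shows "convex_cone hull (v ` J) \<subseteq> F"
proof (rule hull_minimal)
  show "v ` J \<subseteq> F"
    using generator_in_face[OF assms(1-4)] assms(5) open_cone_subset_hull
    by (auto simp: open_cone_def)
  show "convex_cone F" using face_of_cone_convex_cone[OF assms(1,2)] assms(4) by blast
qed

end

text \<open>A simplicial cone comes with some independent generators \<open>G\<close>. Each edge
  contains exactly one of them, and the edge vector is a positive multiple of it; distinct edges and
  the dimension count then match \<open>J\<close> with \<open>G\<close>.\<close>

lemma edge_generators:
  fixes S :: "'a::euclidean_space set" and C :: "'k set \<Rightarrow> 'a set"
  assumes "simplicial_cone S" and fin: "finite J" and dimS: "dim S = card J"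
    and face: "\<And>i. i \<in> J \<Longrightarrow> C {i} face_of S" and dim1: "\<And>i. i \<in> J \<Longrightarrow> dim (C {i}) = 1"
    and v: "\<And>i. i \<in> J \<Longrightarrow> v i \<in> C {i}" "\<And>i. i \<in> J \<Longrightarrow> v i \<noteq> 0"
    and inj: "inj_on (\<lambda>i. C {i}) J"
  shows "indep_family v J" and "S = convex_cone hull (v ` J)"
    and "\<And>i. i \<in> J \<Longrightarrow> C {i} = convex_cone hull {v i}"
proof -
  obtain G where G: "independent G" and SG: "S = convex_cone hull G"
    using assms by (auto simp: simplicial_cone_def)
  interpret g: indep_family "\<lambda>x. x" G
    using G independent_imp_finite by unfold_locales auto
  have S: "convex_cone S" unfolding SG by (rule convex_cone_convex_cone_hull)
  have vS: "v i \<in> S" if "i \<in> J" for i using v face that face_of_imp_subset by blast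
  have FG: "C {i} = convex_cone hull {g \<in> G. g \<in> C {i}}" if "i \<in> J" for i
    using g.face_eq_hull[of "C {i}"] face v that by (auto simp: SG)
  \<comment> \<open>An edge is generated by the members of \<open>G\<close> on it, and these are
    independent, so dimension one leaves a single one.\<close>
  have "\<exists>h. {g \<in> G. g \<in> C {i}} = {h}" if i: "i \<in> J" for i
  proof -
    interpret gi: indep_family "\<lambda>x. x" "{g \<in> G. g \<in> C {i}}"
      using g.subfamily by auto
    have "card {g \<in> G. g \<in> C {i}} = 1"
      using gi.dim_hull FG dim1 i by simp
    then show ?thesis by (simp add: card_1_singleton_iff)
  qed
  then obtain h where h: "\<And>i. i \<in> J \<Longrightarrow> {g \<in> G. g \<in> C {i}} = {h i}" by metis
  have hG: "h i \<in> G" if "i \<in> J" for i using h[OF that] by auto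
  have Ch: "C {i} = convex_cone hull {h i}" if "i \<in> J" for i
    using FG[OF that] h[OF that] by simp
  define c where "c i = g.coord (h i) (v i)" for i
  have c: "0 < c i" "v i = c i *\<^sub>R h i" if i: "i \<in> J" for i
  proof -
    have vi: "v i \<in> span G" "\<And>x. x \<in> G \<Longrightarrow> 0 \<le> g.coord x (v i)"
      using vS[OF i] g.mem_convex_cone_hull_iff[of "v i"] by (auto simp: SG)
    \<comment> \<open>A positive coordinate along another generator would place that generator on
      the edge too.\<close>
    have "g.coord x (v i) = 0" if x: "x \<in> G" "x \<noteq> h i" for x
    proof (rule ccontr)
      assume "g.coord x (v i) \<noteq> 0"
      then have "x \<in> C {i}"
        using g.generator_in_face[of S "C {i}" "v i" x] S face[OF i] v[OF i] vS[OF i] vi x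
        by (force simp: SG)
      then show False using h[OF i] x by blast
    qed
    then have "(\<Sum>x\<in>G. g.coord x (v i) *\<^sub>R x) = (\<Sum>x\<in>{h i}. g.coord x (v i) *\<^sub>R x)"
      using hG[OF i] g.fin by (intro sum.mono_neutral_right) auto
    then show eq: "v i = c i *\<^sub>R h i"
      using g.expansion[of "v i"] vi by (simp add: c_def)
    have "c i \<noteq> 0" using eq v(2)[OF i] by auto
    then show "0 < c i" using vi(2)[OF hG[OF i]] by (simp add: c_def)
  qed
  have hv: "h i = (1 / c i) *\<^sub>R v i" if "i \<in> J" for i using c[OF that] by simp
  have inj_h: "inj_on h J"
  proof (rule inj_onI)
    fix i j assume "i \<in> J" "j \<in> J" "h i = h j"
    then have "C {i} = C {j}" using Ch by simp
    then show "i = j" using inj_onD[OF inj] \<open>i \<in> J\<close> \<open>j \<in> J\<close> by blast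
  qed
  have "card G = card J" using dimS g.dim_hull SG by simp
  then have hJ: "h ` J = G"
    using hG inj_h g.fin by (intro card_subset_eq) (auto simp: card_image)
  have inj_v: "inj_on v J"
  proof (rule inj_onI)
    fix i j assume ij: "i \<in> J" "j \<in> J" "v i = v j"
    then have "(1 / c i) *\<^sub>R v j \<in> C {j}"
      using face_of_cone_scaleR[OF S face, of j "v j" "1 / c i"] v c(1)[of i] by simp
    then have "h i \<in> C {j}" using hv ij by simp
    then have "h i = h j" using h hG ij by blast
    then show "i = j" using inj_h ij by (auto dest: inj_onD)
  qed
  have "h i \<in> span (v ` J)" if "i \<in> J" for i
    unfolding hv[OF that] by (intro span_scale span_base imageI that)
  then have Gv: "G \<subseteq> span (v ` J)" using hJ by blast
  have vG: "v ` J \<subseteq> span G"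
    using vS g.mem_convex_cone_hull_iff by (auto simp: SG)
  have "independent (v ` J)"
  \<comment> \<open>A spanning family with no more members than the dimension is
    independent.\<close>
  proof (rule card_le_dim_spanning)
    show "v ` J \<subseteq> span G" by (rule vG)
    show "span G \<subseteq> span (v ` J)" using Gv span_minimal by blast
    show "finite (v ` J)" using fin by simp
    show "card (v ` J) \<le> dim (span G)"
      using \<open>card G = card J\<close> G by (simp add: card_image inj_v dim_eq_card_independent)
  qed
  then show "indep_family v J" using fin inj_v by unfold_locales
  show "C {i} = convex_cone hull {v i}" if i: "i \<in> J" for i
  proof
    have "convex_cone (C {i})" using face_of_cone_convex_cone[OF S face] v i by blast
    then show "convex_cone hull {v i} \<subseteq> C {i}" using v i by (intro hull_minimal) auto
    have "h i \<in> convex_cone hull {v i}"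
      using c[OF i] unfolding hv[OF i] by (intro convex_cone_hull_mul hull_inc) auto
    then show "C {i} \<subseteq> convex_cone hull {v i}"
      unfolding Ch[OF i] by (intro hull_minimal convex_cone_convex_cone_hull) auto
  qed
  show "S = convex_cone hull (v ` J)"
  proof
    show "convex_cone hull (v ` J) \<subseteq> S" using vS S by (intro hull_minimal) auto
    have "h i \<in> convex_cone hull (v ` J)" if "i \<in> J" for i
      using c[OF that] that unfolding hv[OF that] by (intro convex_cone_hull_mul hull_inc) auto
    then show "S \<subseteq> convex_cone hull (v ` J)"
      unfolding SG hJ[symmetric] by (intro hull_minimal convex_cone_convex_cone_hull) auto
  qed
qed

section \<open>The subdivision identity\<close>

text \<open>For \<open>C I\<close> this is \<open>edge_generators\<close>. Every other face is
  generated by the edge vectors on it, and the order isomorphism identifies these as the ones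
  indexed by \<open>J\<close>.\<close>

lemma face_fan_generators:
  assumes fan: "face_fan L I C" and I: "finite I" and v: "edge_vectors L I C v"
  shows "indep_family v I" and "J \<subseteq> I \<Longrightarrow> C J = convex_cone hull (v ` J)"
    and "J \<subseteq> I \<Longrightarrow> C J face_of C I"
proof -
  note fan = fan[unfolded face_fan_def]
  have face: "C J face_of C I" "C J \<noteq> {}" if "J \<subseteq> I" for J
    using fan that by (auto simp: bij_betw_def cone_faces_def)
  show "C J face_of C I" if "J \<subseteq> I" using face that by blast
  have order: "C J \<subseteq> C K \<longleftrightarrow> J \<subseteq> K" if "J \<subseteq> I" "K \<subseteq> I" for J K
    using fan that by blast
  have inj: "inj_on (\<lambda>i. C {i}) I"
  proof (rule inj_onI)
    fix i j assume "i \<in> I" "j \<in> I" "C {i} = C {j}"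
    then show "i = j" using order[of "{i}" "{j}"] by simp
  qed
  have "dim (C {i}) = card {i}" if "i \<in> I" for i
    using fan that by blast
  then have dim1: "dim (C {i}) = 1" if "i \<in> I" for i using that by simp
  have vC: "v i \<in> C {i}" "v i \<noteq> 0" if "i \<in> I" for i
    using v that by (auto simp: edge_vectors_def)
  note gens = edge_generators[of "C I" I C v, OF _ I _ face(1) dim1 vC inj]
  show "indep_family v I" by (rule gens) (use fan in auto)
  then interpret indep_family v I .
  have CI: "C I = convex_cone hull (v ` I)" by (rule gens) (use fan in auto)
  have Ci: "C {i} = convex_cone hull {v i}" if "i \<in> I" for i
    by (rule gens) (use fan that in auto)
  show "C J = convex_cone hull (v ` J)" if J: "J \<subseteq> I"
  proof -
    have "convex_cone (C J)"
      using face_of_cone_convex_cone[OF convex_cone_convex_cone_hull face(1)[OF J, unfolded CI]]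
        face(2)[OF J] by blast
    \<comment> \<open>\<open>C {i}\<close> is the ray of \<open>v i\<close>, and the convex cone
      \<open>C J\<close> contains a ray as soon as it contains its generator.\<close>
    then have "v i \<in> C J \<longleftrightarrow> C {i} \<subseteq> C J" if "i \<in> I" for i
      using hull_minimal[of "{v i}" "C J" convex_cone] hull_inc[of "v i" "{v i}" convex_cone]
      unfolding Ci[OF that] by auto
    moreover have "C {i} \<subseteq> C J \<longleftrightarrow> i \<in> J" if "i \<in> I" for i
      using order[of "{i}" J] J that by simp
    ultimately have "{i \<in> I. v i \<in> C J} = J" using J by auto
    then show ?thesis using face_eq_hull[of "C J"] face[OF J] CI by simp
  qed
qed

lemma simplicial_fan_order:
  assumes "simplicial_fan L \<Sigma> C" "J \<in> \<Sigma>" "K \<in> \<Sigma>"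
  shows "C J \<subseteq> C K \<longleftrightarrow> J \<subseteq> K"
  using assms unfolding simplicial_fan_def by simp

lemma simplicial_fan_inter_face:
  assumes "simplicial_fan L \<Sigma> C" "J \<in> \<Sigma>" "K \<in> \<Sigma>"
  shows "C J \<inter> C K face_of C J"
proof -
  have "\<forall>S\<in>C ` \<Sigma>. \<forall>T\<in>C ` \<Sigma>. S \<inter> T \<in> cone_faces S \<and> S \<inter> T \<in> cone_faces T"
    using assms(1) unfolding simplicial_fan_def is_fan_def by (elim conjE)
  then have "C J \<inter> C K \<in> cone_faces (C J)" using assms(2,3) by simp
  then show ?thesis by (simp add: cone_faces_def)
qed

lemma simplicial_fan_generators:
  assumes fan: "simplicial_fan L \<Sigma> C" and v: "edge_vectors L (vertices \<Sigma>) C v" and J: "J \<in> \<Sigma>"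
  shows "indep_family v J" and "C J = convex_cone hull (v ` J)"
proof -
  note order = simplicial_fan_order[OF fan]
  have props: "simplicial_cone (C J)" "finite J" "dim (C J) = card J"
    and sing: "\<And>i. i \<in> J \<Longrightarrow> {i} \<in> \<Sigma>"
    using fan J by (auto simp: simplicial_fan_def abstract_complex_def)
  have face: "C {i} face_of C J" if i: "i \<in> J" for i
  proof -
    have "C {i} \<subseteq> C J" using order[of "{i}" J] sing[OF i] J i by simp
    \<comment> \<open>Writing the edge as an intersection of two cones of the fan makes it a
      face.\<close>
    then have "C J \<inter> C {i} = C {i}" by blast
    then show ?thesis using simplicial_fan_inter_face[OF fan J sing[OF i]] by simp
  qed
  have "dim (C {i}) = card {i}" if "i \<in> J" for i
    using fan sing[OF that] by (simp add: simplicial_fan_def)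
  then have dim1: "dim (C {i}) = 1" if "i \<in> J" for i using that by simp
  have vC: "v i \<in> C {i}" "v i \<noteq> 0" if "i \<in> J" for i
    using v sing[OF that] by (auto simp: edge_vectors_def vertices_def)
  have inj: "inj_on (\<lambda>i. C {i}) J"
  proof (rule inj_onI)
    fix i j assume "i \<in> J" "j \<in> J" "C {i} = C {j}"
    then show "i = j" using order[of "{i}" "{j}"] sing by simp
  qed
  show "indep_family v J"
    by (rule edge_generators(1)[OF props]) (use face dim1 vC inj in auto)
  show "C J = convex_cone hull (v ` J)"
    by (rule edge_generators(2)[OF props]) (use face dim1 vC inj in auto)
qed

lemma sum_indicator_eq:
  assumes "finite A" and ex: "P x \<Longrightarrow> \<exists>!a. a \<in> A \<and> x \<in> S a" and no: "\<not> P x \<Longrightarrow> \<forall>a\<in>A. x \<notin> S a"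
  shows "(\<Sum>a\<in>A. indicator (S a) x) = (if P x then 1 else 0 :: complex)"
proof (cases "P x")
  case True
  then obtain a where a: "a \<in> A" "x \<in> S a" "\<And>b. b \<in> A \<Longrightarrow> x \<in> S b \<Longrightarrow> b = a" using ex by blast
  have "\<forall>b\<in>A - {a}. indicator (S b) x = (0 :: complex)"
    using a(3) by (auto simp: indicator_def)
  then have "(\<Sum>b\<in>A. indicator (S b) x) = (\<Sum>b\<in>{a}. indicator (S b) x :: complex)"
    using assms(1) a(1) by (intro sum.mono_neutral_right) auto
  then show ?thesis using True a(2) by simp
next
  case False
  then show ?thesis using no by (auto intro!: sum.neutral)
qed

text \<open>One relative interior point \<open>w\<close> determines the minimal face:
  \<open>\<rho>(J')\<close> is the support of its coordinates. This also shows that the least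
  element in \<open>carrier_face\<close> exists.\<close>

lemma carrier_face_eq:
  assumes fan: "face_fan L I C" and I: "finite I" and v: "edge_vectors L I C v"
    and J': "indep_family v' J'" and C': "C' J' = convex_cone hull (v' ` J')"
    and sub: "C' J' \<subseteq> C I" and w: "w \<in> indep_family.open_cone v' J'"
  shows "carrier_face C' (Pow I) C J' = {i \<in> I. 0 < dual_coord v I i w}"
proof -
  interpret v: indep_family v I using face_fan_generators(1)[OF assms(1-3)] .
  interpret v': indep_family v' J' by (rule J')
  note gen = face_fan_generators[OF assms(1-3)]
  let ?T = "{i \<in> I. 0 < dual_coord v I i w}"
  have wC: "w \<in> C' J'" using w v'.open_cone_subset_hull C' by blast
  then have wI: "w \<in> convex_cone hull (v ` I)" using sub gen(2)[of I] by blast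
  have T: "w \<in> C ?T"
    using v.mem_open_subcone_iff[of ?T w] wI gen(2)[of ?T]
      indep_family.open_cone_subset_hull[OF v.subfamily, of ?T] by blast
  \<comment> \<open>The face \<open>C ?T\<close> contains the interior point \<open>w\<close>, hence
    the whole cone.\<close>
  have "C' J' \<subseteq> C ?T"
    unfolding C'
  proof (rule v'.hull_subset_face[OF _ gen(3) _ T w])
    show "convex_cone (C I)" using gen(2)[of I] by (simp add: convex_cone_convex_cone_hull)
    show "convex_cone hull (v' ` J') \<subseteq> C I" using sub C' by simp
  qed auto
  moreover have "?T \<subseteq> K" if K: "K \<in> Pow I" "C' J' \<subseteq> C K" for K
  proof -
    have "w \<in> convex_cone hull (v ` K)" using gen(2)[of K] K wC by auto
    then have "\<forall>i\<in>I - K. v.coord i w = 0" using v.mem_subcone_iff K by blast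
    then show ?thesis by force
  qed
  ultimately show ?thesis
    unfolding carrier_face_def by (intro Least_equality) auto
qed

section \<open>The functions \<open>b_J\<close> as values of formal sums\<close>

lemma expi_add: "expi s (a + b) = expi s a * expi s b"
  by (simp add: expi_def exp_add[symmetric] ring_distribs)

text \<open>If the product were one, \<open>a * \<sigma> + b * \<tau>\<close> would be an integer,
  and integrality of \<open>b\<close> would put \<open>a * \<sigma>\<close> in the period lattice.
  This keeps the denominators nonzero.\<close>

lemma expi_mult_neq_1:
  assumes "b \<in> \<int>" "of_real a * \<sigma> \<notin> period_lattice \<tau>"
  shows "expi \<sigma> a * expi \<tau> b \<noteq> 1"
proof
  assume "expi \<sigma> a * expi \<tau> b = 1"
  then have "exp (2 * of_real pi * \<i> * (of_real a * \<sigma> + of_real b * \<tau>)) = 1"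
    by (simp add: expi_def exp_add[symmetric] ring_distribs mult.assoc)
  then obtain n where n: "Re (2 * of_real pi * \<i> * (of_real a * \<sigma> + of_real b * \<tau>)) = 0"
      "Im (2 * of_real pi * \<i> * (of_real a * \<sigma> + of_real b * \<tau>)) = of_int (2 * n) * pi"
    unfolding exp_eq_1 by blast
  then have "of_real a * \<sigma> + of_real b * \<tau> = of_int n"
    by (simp add: complex_eq_iff)
  moreover obtain m where "b = of_int m" using assms by (auto elim: Ints_cases)
  ultimately have "of_real a * \<sigma> = of_int n + of_int (- m) * \<tau>"
    by (simp add: algebra_simps)
  then show False using assms unfolding period_lattice_def by blast
qed

text \<open>Rewrites the sum over \<open>H_J\<close> as one over the half-open box and recognises
  the value of the negative open cone. As \<open>\<phi>\<close> is any linear form with the right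
  values on the edges, one \<open>\<omega>\<close> can serve both fans.\<close>

lemma (in indep_family) has_value_b_fun:
  fixes u \<phi> :: "'a \<Rightarrow> real" and \<sigma> \<tau> :: complex
  defines "\<omega> \<equiv> \<lambda>w. expi \<sigma> (\<phi> w) * expi \<tau> (u w)"
  assumes L: "is_lattice L" and vL: "v ` J \<subseteq> L" and C: "C J = convex_cone hull (v ` J)"
    and u: "u \<in> dual_lattice L" and \<phi>: "linear \<phi>" and d: "\<And>j. j \<in> J \<Longrightarrow> \<phi> (v j) = d j"
    and nonper: "\<And>j. j \<in> J \<Longrightarrow> of_real (d j) * \<sigma> \<notin> period_lattice \<tau>"
  shows "has_value \<omega> (indicator {w \<in> L. - w \<in> open_cone})
           ((- 1) ^ DIM('a) * b_fun \<tau> \<sigma> L C v d J u)"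
proof -
  have lu: "linear u" and uL: "\<And>w. w \<in> L \<Longrightarrow> u w \<in> \<int>" using u by (auto simp: dual_lattice_def)
  have chr: "character \<omega>"
    by unfold_locales (simp add: \<omega>_def linear_add[OF lu] linear_add[OF \<phi>] expi_add)
  have ne: "\<omega> (v j) \<noteq> 1" if "j \<in> J" for j
    unfolding \<omega>_def d[OF that] using that vL by (intro expi_mult_neq_1 uL nonper) auto
  have "span (C J) = span (v ` J)" by (simp add: C span_convex_cone_hull)
  note sum = sum_H_quot[of L C, OF L vL this]
  have "b_fun \<tau> \<sigma> L C v d J u = (- 1) ^ (DIM('a) - card J) *
      (\<Sum>w\<in>half_open_box L. expi \<sigma> (\<Sum>i\<in>J. d i * coord i w) * expi \<tau> (u w) *
        (\<Prod>i\<in>J. 1 / (1 - expi \<sigma> (d i) * expi \<tau> (u (v i)))))"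
    unfolding b_fun_def frac_weight_def
    by (subst sum[of "\<lambda>w. expi \<sigma> (\<Sum>i\<in>J. d i * coord i w) * expi \<tau> (u w) *
        (\<Prod>i\<in>J. 1 / (1 - expi \<sigma> (d i) * expi \<tau> (u (v i))))", symmetric]) simp
  also have "\<dots> = (- 1) ^ (DIM('a) - card J) *
      (\<Sum>w\<in>half_open_box L. \<omega> w * (\<Prod>j\<in>J. 1 / (1 - \<omega> (v j))))"
  proof -
    have "(\<Sum>i\<in>J. d i * coord i w) = \<phi> w" if "w \<in> half_open_box L" for w
      using linear_by_coord[OF \<phi>, of w] that d by (simp add: half_open_box_def)
    then show ?thesis by (simp add: \<omega>_def d)
  qed
  finally have b: "b_fun \<tau> \<sigma> L C v d J u = (- 1) ^ (DIM('a) - card J) *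
      (\<Sum>w\<in>half_open_box L. \<omega> w * (\<Prod>j\<in>J. 1 / (1 - \<omega> (v j))))" .
  \<comment> \<open>Makes the truncated subtraction in the sign a true difference; the two exponents
    then add up to \<open>card J\<close> plus an even number.\<close>
  have "card J \<le> DIM('a)"
    using independent_card_le[OF indep] by (simp add: card_image inj)
  then have "DIM('a) + (DIM('a) - card J) = 2 * (DIM('a) - card J) + card J" by simp
  then have "(- 1 :: complex) ^ DIM('a) * (- 1) ^ (DIM('a) - card J) = (- 1) ^ card J"
    by (simp only: power_add[symmetric]) (simp add: power_add power_mult)
  then have "(- 1) ^ DIM('a) * b_fun \<tau> \<sigma> L C v d J u = (- 1) ^ card J *
      (\<Sum>w\<in>half_open_box L. \<omega> w * (\<Prod>j\<in>J. 1 / (1 - \<omega> (v j))))"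
    unfolding b mult.assoc[symmetric] by simp
  then show ?thesis using has_value_neg_open_cone[OF L vL chr ne] by simp
qed

theorem theorem7p1:
  fixes n :: nat
    and L :: "'a::euclidean_space set"
    and I :: "'i set"
    and C :: "'i set \<Rightarrow> 'a set"
    and \<Sigma>' :: "'k set set"
    and C' :: "'k set \<Rightarrow> 'a set"
    and \<kappa> :: "'i \<Rightarrow> 'k"
    and v :: "'i \<Rightarrow> 'a" and v' :: "'k \<Rightarrow> 'a"
    and d :: "'i \<Rightarrow> real" and d' :: "'k \<Rightarrow> real"
    and \<tau> \<sigma> :: complex
  assumes "n \<ge> 1" and "DIM('a) = n" and "is_lattice L"
    and "finite I" and "card I = n"
    and "face_fan L I C"
    and "simplicial_fan L \<Sigma>' C'"
    and "inj_on \<kappa> I" and "\<kappa> ` I \<subseteq> vertices \<Sigma>'" and "\<And>i. i \<in> I \<Longrightarrow> C {i} = C' {\<kappa> i}"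
    and "fan_refinement L \<Sigma>' C' (Pow I) C"
    and "edge_vectors L I C v"
    and "edge_vectors L (vertices \<Sigma>') C' v'"
    and "\<And>i. i \<in> I \<Longrightarrow> d i \<in> \<rat>"
    and "d' = pullback_divisor I v d v'"
    and "Im \<tau> > 0"
    and "\<And>i. i \<in> I \<Longrightarrow> of_real (d i) * \<sigma> \<notin> period_lattice \<tau>"
    and "\<And>i'. i' \<in> vertices \<Sigma>' \<Longrightarrow> of_real (d' i') * \<sigma> \<notin> period_lattice \<tau>"
  shows "\<forall>J. J \<subseteq> I \<longrightarrow>
    (\<forall>u\<in>dual_lattice L. b_diff \<tau> \<sigma> L \<Sigma>' C' v' d' (Pow I) C v d J u = 0)"
proof (intro allI impI ballI)
  fix J u assume J: "J \<subseteq> I" and u: "u \<in> dual_lattice L"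
  note L = \<open>is_lattice L\<close> and I = \<open>finite I\<close> and fan = \<open>face_fan L I C\<close>
    and fan' = \<open>simplicial_fan L \<Sigma>' C'\<close> and ref = \<open>fan_refinement L \<Sigma>' C' (Pow I) C\<close>
    and ev = \<open>edge_vectors L I C v\<close> and ev' = \<open>edge_vectors L (vertices \<Sigma>') C' v'\<close>
  note gen = face_fan_generators[OF fan I ev] and gen' = simplicial_fan_generators[OF fan' ev']
  interpret I: indep_family v I by (rule gen)
  interpret J: indep_family v J by (rule I.subfamily[OF J])
  have vert: "J' \<subseteq> vertices \<Sigma>'" and sub': "\<And>K. K \<subseteq> J' \<Longrightarrow> K \<in> \<Sigma>'" if "J' \<in> \<Sigma>'" for J'
    using fan' that by (auto simp: simplicial_fan_def abstract_complex_def vertices_def)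
  have fin': "finite \<Sigma>'" using fan' by (simp add: simplicial_fan_def abstract_complex_def)
  have CI: "C I = convex_cone hull (v ` I)" by (rule gen) simp
  \<comment> \<open>The \<open>n\<close> edge vectors form a basis of the ambient space, so
    coordinates, and with them \<open>\<phi>\<close> below, are linear everywhere.\<close>
  have spanI: "span (v ` I) = UNIV"
  proof -
    have "dim (span (v ` I)) = DIM('a)"
      using I.dim_hull I.span_convex_cone_hull assms(2,5) by (metis dim_span)
    then show ?thesis by (metis dim_eq_full span_span)
  qed
  have C'_sub: "C' J' \<subseteq> C I" if "J' \<in> \<Sigma>'" for J'
  proof -
    have "\<exists>K\<in>Pow I. C' J' \<subseteq> C K"
      using ref[unfolded fan_refinement_def, THEN conjunct1] that by (rule bspec)
    then obtain K where "K \<subseteq> I" "C' J' \<subseteq> C K" by auto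
    then show ?thesis using face_of_imp_subset[OF gen(3)[of K]] by simp
  qed
  define rint where "rint K = indep_family.open_cone v' K" for K
  define \<rho> where "\<rho> = carrier_face C' (Pow I) C"
  define A where "A = {J' \<in> \<Sigma>'. \<rho> J' = J}"
  have rint_sub: "rint J' \<subseteq> C' J'" if "J' \<in> \<Sigma>'" for J'
    using indep_family.open_cone_subset_hull[OF gen'(1)[OF that]] gen'(2)[OF that]
    by (simp add: rint_def)
  have supp: "\<rho> J' = {i \<in> I. 0 < I.coord i x}" "x \<in> C I" if "J' \<in> \<Sigma>'" "x \<in> rint J'" for J' x
  proof -
    show "\<rho> J' = {i \<in> I. 0 < I.coord i x}"
      using carrier_face_eq[where C' = C', OF fan I ev gen'[OF that(1)] C'_sub[OF that(1)], of x] that(2)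
      by (simp add: rint_def \<rho>_def)
    show "x \<in> C I" using C'_sub[OF that(1)] rint_sub[OF that(1)] that(2) by blast
  qed
  \<comment> \<open>The intersection of the two cones is a face of the first through one of its
    interior points, hence all of it. Used in both directions, this makes distinct relative
    interiors disjoint.\<close>
  have le: "J1 \<subseteq> J2" if "J1 \<in> \<Sigma>'" "J2 \<in> \<Sigma>'" "x \<in> rint J1" "x \<in> rint J2" for J1 J2 x
  proof -
    interpret J1: indep_family v' J1 by (rule gen') fact
    have "C' J1 \<inter> C' J2 face_of C' J1"
      using simplicial_fan_inter_face[OF fan'] that by blast
    moreover have "x \<in> C' J1 \<inter> C' J2"
      using that rint_sub by blast
    ultimately have "C' J1 \<subseteq> C' J1 \<inter> C' J2"
      using J1.hull_subset_face[of "C' J1" "C' J1 \<inter> C' J2" x] that gen'(2)[OF that(1)]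
      by (simp add: rint_def convex_cone_convex_cone_hull)
    then show ?thesis using simplicial_fan_order[OF fan' that(1,2)] by simp
  qed
  have ex: "\<exists>J'\<in>\<Sigma>'. x \<in> rint J'" if x: "x \<in> C I" for x
  proof -
    have "subdivides L {C' J' | J'. J' \<in> \<Sigma>' \<and> C' J' \<subseteq> C I} (C I)"
      by (rule bspec[OF ref[unfolded fan_refinement_def, THEN conjunct2]]) simp
    then have "x \<in> \<Union> {C' J' | J'. J' \<in> \<Sigma>' \<and> C' J' \<subseteq> C I}"
      using x unfolding subdivides_def by metis
    then obtain K where K: "K \<in> \<Sigma>'" "x \<in> C' K" by blast
    interpret K: indep_family v' K by (rule gen') fact
    \<comment> \<open>Dropping the generators with zero coordinate gives the face of
      \<open>K\<close> whose relative interior contains \<open>x\<close>.\<close>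
    have "x \<in> rint {j \<in> K. 0 < K.coord j x}"
      using K.mem_open_subcone_iff[of "{j \<in> K. 0 < K.coord j x}" x] K(2) gen'(2)[OF K(1)]
      by (simp add: rint_def)
    moreover have "{j \<in> K. 0 < K.coord j x} \<in> \<Sigma>'" by (rule sub'[OF K(1)]) simp
    ultimately show ?thesis by (rule bexI)
  qed
  have openJ: "x \<in> J.open_cone \<longleftrightarrow> x \<in> C I \<and> J = {i \<in> I. 0 < I.coord i x}" for x
    using I.mem_open_subcone_iff[OF J] CI by simp
  \<comment> \<open>The relatively open cones with carrier \<open>J\<close> partition the relative
    interior of \<open>C J\<close>; here as an identity of indicators on the reflected lattice
    points.\<close>
  have part: "(\<Sum>J'\<in>A. indicator {w \<in> L. - w \<in> rint J'} w)
      = (indicator {w \<in> L. - w \<in> J.open_cone} w :: complex)" for w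
  proof -
    have "(\<Sum>J'\<in>A. indicator {w \<in> L. - w \<in> rint J'} w)
      = (if w \<in> L \<and> - w \<in> J.open_cone then 1 else 0 :: complex)"
    proof (rule sum_indicator_eq)
      show "finite A" using fin' by (simp add: A_def)
      assume w: "w \<in> L \<and> - w \<in> J.open_cone"
      then obtain J' where J': "J' \<in> \<Sigma>'" "- w \<in> rint J'" using ex openJ by blast
      moreover have "\<rho> J' = J" using supp(1)[OF J'] w openJ by simp
      ultimately show "\<exists>!J'. J' \<in> A \<and> w \<in> {w \<in> L. - w \<in> rint J'}"
        using w le unfolding A_def by (intro ex1I[of _ J']) blast+
    next
      assume "\<not> (w \<in> L \<and> - w \<in> J.open_cone)"
      then show "\<forall>J'\<in>A. w \<notin> {w \<in> L. - w \<in> rint J'}"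
        using supp openJ by (auto simp: A_def)
    qed
    then show ?thesis by (simp add: indicator_def)
  qed
  define \<phi> where "\<phi> w = (\<Sum>i\<in>I. I.coord i w * d i)" for w
  define \<omega> where "\<omega> w = expi \<sigma> (\<phi> w) * expi \<tau> (u w)" for w
  have \<phi>: "linear \<phi>"
    by (rule linearI)
      (simp_all add: \<phi>_def spanI I.coord_add I.coord_scaleR ring_distribs sum.distrib
        sum_distrib_left mult.assoc)
  have \<phi>_v: "\<phi> (v i) = d i" if "i \<in> I" for i
  proof -
    have "\<phi> (v i) = (\<Sum>j\<in>I. if i = j then d j else 0)"
      unfolding \<phi>_def by (rule sum.cong) (use that in \<open>auto simp: I.coord_basis\<close>)
    then show ?thesis using I that by simp
  qed
  \<comment> \<open>The pull-back formula is evaluation of \<open>\<phi>\<close> at the new edge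
    vectors, so both fans share the character \<open>\<omega>\<close>.\<close>
  have \<phi>_v': "\<phi> (v' i) = d' i" for i
    by (simp add: \<phi>_def \<open>d' = _\<close> pullback_divisor_def)
  interpret character \<omega>
    using u \<phi> by unfold_locales
      (simp add: \<omega>_def dual_lattice_def linear_add expi_add)
  have "has_value \<omega> (indicator {w \<in> L. - w \<in> J.open_cone})
      ((- 1) ^ DIM('a) * b_fun \<tau> \<sigma> L C v d J u)"
    unfolding \<omega>_def[abs_def]
  proof (rule J.has_value_b_fun[OF L])
    show "v ` J \<subseteq> L" using J ev by (auto simp: edge_vectors_def)
    show "C J = convex_cone hull (v ` J)" by (rule gen) (rule J)
  qed (use J u \<phi> \<phi>_v assms(17) in auto)
  moreover have "has_value \<omega> (indicator {w \<in> L. - w \<in> J.open_cone})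
      (\<Sum>J'\<in>A. (- 1) ^ DIM('a) * b_fun \<tau> \<sigma> L C' v' d' J' u)"
    unfolding part[symmetric, abs_def]
  proof (rule has_value_sum)
    show "finite A" using fin' by (simp add: A_def)
    fix J' assume "J' \<in> A"
    then have J': "J' \<in> \<Sigma>'" by (simp add: A_def)
    show "has_value \<omega> (indicator {w \<in> L. - w \<in> rint J'})
        ((- 1) ^ DIM('a) * b_fun \<tau> \<sigma> L C' v' d' J' u)"
      unfolding \<omega>_def[abs_def] rint_def
    proof (rule indep_family.has_value_b_fun[OF _ L])
      show "indep_family v' J'" "C' J' = convex_cone hull (v' ` J')" by (rule gen'[OF J'])+
      show "v' ` J' \<subseteq> L" using vert[OF J'] ev' by (auto simp: edge_vectors_def)
    qed (use vert[OF J'] u \<phi> \<phi>_v' assms(18) in auto)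
  qed
  \<comment> \<open>Both computations evaluate the same indicator at \<open>\<omega>\<close>; the
    common sign is cancelled afterwards.\<close>
  ultimately have "(- 1) ^ DIM('a) * b_fun \<tau> \<sigma> L C v d J u =
      (\<Sum>J'\<in>A. (- 1) ^ DIM('a) * b_fun \<tau> \<sigma> L C' v' d' J' u)"
    by (rule has_value_unique)
  then have "b_fun \<tau> \<sigma> L C v d J u = (\<Sum>J'\<in>A. b_fun \<tau> \<sigma> L C' v' d' J' u)"
    by (simp add: sum_distrib_left[symmetric])
  then show "b_diff \<tau> \<sigma> L \<Sigma>' C' v' d' (Pow I) C v d J u = 0"
    by (simp add: b_diff_def A_def \<rho>_def)
qed

end
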